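(* Let $\alpha=-1/d$, where $d\ge2$ is an integer, and let $p\in[0,1]$ with $p>-\alpha=1/d$. Let $\mathcal{C}_n$ be the root cluster of $\mathcal{T}_n=\mathcal{T}_{-1/d,n}$ with broadcasting induced colouring with parameter $p$. Then, as $n\to\infty$, $$\frac{|\mathcal{C}_n|}{n^{(pd-1)/(d-1)}}\xrightarrow{d}\mathcal{C},$$ where $\mathcal{C}$ is a random variable with integer moments, for all integers $k\ge1$, $$\mathbb{E}[\mathcal{C}^k]=\frac{D_k\,\Gamma(1/(d-1))}{\Gamma((kpd-k+1)/(d-1))},$$ where $D_k$ satisfies the recursion $D_1=1/(pd-1)$ and, for $k\ge2$, $$(k-1)(pd-1)D_k=\sum_{j=2}^{\min\{k,d\}}\frac{p^j\,d!}{(d-j)!}B_{k,j}(D_1,\ldots,D_{k-j+1}).$$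
   Context: The random trees $(\mathcal{T}_n)_{n\ge1}=(\mathcal{T}_{-1/d,n})_{n\ge1}$ are rooted trees grown recursively: $\mathcal{T}_1$ is a single vertex $\rho$, the root of all the trees; $\mathcal{T}_n$ is obtained from $\mathcal{T}_{n-1}$ by choosing a vertex $v$ of $\mathcal{T}_{n-1}$ at random with probability $\frac{1-\deg^+(v)/d}{\sum_{u\in V(\mathcal{T}_{n-1})}(1-\deg^+(u)/d)}$ and adding a new child to $v$, where $\deg^+(u)$ is the number of children of $u$ in $\mathcal{T}_{n-1}$. The broadcasting induced colouring of $\mathcal{T}_n$ with parameter $p$: the root is red or blue with probability $1/2$ each, and every other vertex, when added, receives the colour of its parent with probability $p$ and the other colour with probability $1-p$, independently of everything else. The root cluster $\mathcal{C}_n$ is the maximal monochromatic (connected) subtree of $\mathcal{T}_n$ containing the root, and $|\mathcal{C}_n|$ is its number of vertices. The partial Bell polynomials are $$B_{k,j}(x_1,\ldots,x_{k-j+1})=\sum_{\substack{m_1+2m_2+\cdots+(k-j+1)m_{k-j+1}=k\\ m_1+\cdots+m_{k-j+1}=j}}k!\prod_{i=1}^{k-j+1}\frac{x_i^{m_i}}{m_i!\,(i!)^{m_i}},$$ the sum being over nonnegative integers $m_i$. *)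

theory Defs
  imports "HOL-Probability.Probability"
begin

section \<open>Broadcasting on the random recursive trees with parameter \<open>-1/d\<close>\<close>

datatype colour = Red | Blue

fun opposite :: "colour \<Rightarrow> colour" where
  "opposite Red = Blue"
| "opposite Blue = Red"

text \<open>
  Vertices are numbered by their order of arrival, the root being 1, so that a tree determines
  all its predecessors. Edges point from parent to child. The colouring matters on \<open>verts\<close> only.
\<close>

record coloured_tree =
  verts :: "nat set"
  edges :: "(nat \<times> nat) set"
  colour_of :: "nat \<Rightarrow> colour"

definition outdeg :: "coloured_tree \<Rightarrow> nat \<Rightarrow> nat" where
  "outdeg t v = card {w. (v, w) \<in> edges t}"

definition single_vertex :: "colour \<Rightarrow> coloured_tree" where
  "single_vertex c = \<lparr>verts = {1}, edges = {}, colour_of = (\<lambda>_. undefined)(1 := c)\<rparr>"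

definition add_child :: "coloured_tree \<Rightarrow> nat \<Rightarrow> colour \<Rightarrow> coloured_tree" where
  "add_child t v c =
     (let w = Suc (card (verts t)) in
      \<lparr>verts = insert w (verts t), edges = insert (v, w) (edges t),
       colour_of = (colour_of t)(w := c)\<rparr>)"

definition weight :: "nat \<Rightarrow> coloured_tree \<Rightarrow> nat \<Rightarrow> real" where
  "weight d t v = 1 - real (outdeg t v) / real d"

text \<open>
  \<open>embed_pmf\<close> is meaningful only for nonnegative functions of total mass 1; see
  \<open>pmf_parent_pmf\<close> below for the trees that actually occur.
\<close>

definition parent_pmf :: "nat \<Rightarrow> coloured_tree \<Rightarrow> nat pmf" where
  "parent_pmf d t =
     embed_pmf (\<lambda>v. if v \<in> verts t then weight d t v / (\<Sum>u\<in>verts t. weight d t u) else 0)"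

definition grow :: "nat \<Rightarrow> real \<Rightarrow> coloured_tree \<Rightarrow> coloured_tree pmf" where
  "grow d p t =
     do {
       v \<leftarrow> parent_pmf d t;
       same \<leftarrow> bernoulli_pmf p;
       return_pmf (add_child t v
         (if same then colour_of t v else opposite (colour_of t v)))
     }"

text \<open>The law of the coloured tree with \<open>n\<close> vertices; the value at \<open>n = 0\<close> is junk.\<close>

fun tree_pmf :: "nat \<Rightarrow> real \<Rightarrow> nat \<Rightarrow> coloured_tree pmf" where
  "tree_pmf d p 0 = map_pmf single_vertex (pmf_of_set {Red, Blue})"
| "tree_pmf d p (Suc 0) = map_pmf single_vertex (pmf_of_set {Red, Blue})"
| "tree_pmf d p (Suc (Suc n)) = bind_pmf (tree_pmf d p (Suc n)) (grow d p)"


section \<open>The root cluster\<close>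

text \<open>Connectedness of the subgraph induced by \<open>S\<close>, with edge directions ignored.\<close>

definition connected_in :: "coloured_tree \<Rightarrow> nat set \<Rightarrow> bool" where
  "connected_in t S \<longleftrightarrow>
     (\<forall>u\<in>S. \<forall>v\<in>S. (u, v) \<in> ((edges t \<union> (edges t)\<inverse>) \<inter> S \<times> S)\<^sup>*)"

definition root_mono_subtree :: "coloured_tree \<Rightarrow> nat set \<Rightarrow> bool" where
  "root_mono_subtree t S \<longleftrightarrow>
     S \<subseteq> verts t \<and> 1 \<in> S \<and> connected_in t S \<and> (\<exists>c. \<forall>v\<in>S. colour_of t v = c)"

text \<open>The union is itself such a subtree, hence the largest one: see \<open>root_cluster_greatest\<close>.\<close>

definition root_cluster :: "coloured_tree \<Rightarrow> nat set" where
  "root_cluster t = \<Union>{S. root_mono_subtree t S}"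

lemma root_cluster_greatest:
  assumes "1 \<in> verts t"
  shows "root_mono_subtree t (root_cluster t)"
    and "root_mono_subtree t S \<Longrightarrow> S \<subseteq> root_cluster t"
proof -
  show "root_mono_subtree t S \<Longrightarrow> S \<subseteq> root_cluster t"
    by (auto simp: root_cluster_def)
  let ?R = "\<lambda>S. (edges t \<union> (edges t)\<inverse>) \<inter> S \<times> S"
  have lift: "(u, v) \<in> (?R (root_cluster t))\<^sup>*"
    if "root_mono_subtree t S" "u \<in> S" "v \<in> S" for S u v
  proof -
    have "(u, v) \<in> (?R S)\<^sup>*"
      using that by (auto simp: root_mono_subtree_def connected_in_def)
    moreover have "S \<subseteq> root_cluster t"
      using that by (auto simp: root_cluster_def)
    then have "?R S \<subseteq> ?R (root_cluster t)" by blast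
    ultimately show ?thesis using rtrancl_mono by blast
  qed
  have "connected_in t (root_cluster t)"
    unfolding connected_in_def
  proof (intro ballI)
    fix u v assume "u \<in> root_cluster t" "v \<in> root_cluster t"
    then obtain S S' where S: "root_mono_subtree t S" "u \<in> S"
      and S': "root_mono_subtree t S'" "v \<in> S'"
      by (auto simp: root_cluster_def)
    then have "1 \<in> S" "1 \<in> S'" by (auto simp: root_mono_subtree_def)
    with S S' show "(u, v) \<in> (?R (root_cluster t))\<^sup>*"
      using lift[of S u 1] lift[of S' 1 v] by (meson rtrancl_trans)
  qed
  moreover have "\<forall>v\<in>root_cluster t. colour_of t v = colour_of t 1"
    unfolding root_cluster_def root_mono_subtree_def by (clarify, metis)
  moreover have "root_mono_subtree t {1}"
    using assms by (auto simp: root_mono_subtree_def connected_in_def)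
  then have "1 \<in> root_cluster t" by (auto simp: root_cluster_def)
  moreover have "root_cluster t \<subseteq> verts t"
    by (auto simp: root_cluster_def root_mono_subtree_def)
  ultimately show "root_mono_subtree t (root_cluster t)"
    unfolding root_mono_subtree_def by blast
qed


section \<open>Partial Bell polynomials\<close>

text \<open>For \<open>1 \<le> j \<le> k\<close>; \<open>x\<close> stands for the sequence \<open>x 1, x 2, \<dots>\<close>.\<close>

definition bell_index :: "nat \<Rightarrow> nat \<Rightarrow> (nat \<Rightarrow> nat) set" where
  "bell_index k j =
     {m \<in> {1..k-j+1} \<rightarrow>\<^sub>E UNIV. (\<Sum>i=1..k-j+1. i * m i) = k \<and> (\<Sum>i=1..k-j+1. m i) = j}"

definition bell_poly :: "nat \<Rightarrow> nat \<Rightarrow> (nat \<Rightarrow> real) \<Rightarrow> real" where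
  "bell_poly k j x =
     (\<Sum>m\<in>bell_index k j. fact k * (\<Prod>i=1..k-j+1. x i ^ m i / (fact (m i) * fact i ^ m i)))"

lemma finite_bell_index: "finite (bell_index k j)"
proof (rule finite_subset)
  show "bell_index k j \<subseteq> {1..k-j+1} \<rightarrow>\<^sub>E {..j}"
  proof
    fix m assume m: "m \<in> bell_index k j"
    have "m i \<le> j" if "i \<in> {1..k-j+1}" for i
      using m member_le_sum[OF that, of m] by (auto simp: bell_index_def)
    then show "m \<in> {1..k-j+1} \<rightarrow>\<^sub>E {..j}"
      using m by (auto simp: bell_index_def PiE_iff)
  qed
qed (simp add: finite_PiE)


section \<open>The attachment probabilities are well defined\<close>

definition proper_tree :: "nat \<Rightarrow> nat \<Rightarrow> coloured_tree \<Rightarrow> bool" where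
  "proper_tree d n t \<longleftrightarrow>
     verts t = {1..n} \<and> edges t \<subseteq> {1..n} \<times> {1..n} \<and> card (edges t) = n - 1 \<and>
     (\<forall>v. outdeg t v \<le> d)"

lemma sum_weight:
  assumes "proper_tree d n t" "n \<ge> 1"
  shows "(\<Sum>v\<in>verts t. weight d t v) = real n - (real n - 1) / real d"
proof -
  have fin: "finite {w. (v, w) \<in> edges t}" for v
    using assms finite_subset[of "{w. (v, w) \<in> edges t}" "{1..n}"]
    by (auto simp: proper_tree_def)
  have "edges t = (SIGMA v:{1..n}. {w. (v, w) \<in> edges t})"
    using assms by (auto simp: proper_tree_def)
  then have "card (edges t) = (\<Sum>v\<in>{1..n}. outdeg t v)"
    using fin by (metis (no_types, lifting) card_SigmaI finite_atLeastAtMost outdeg_def sum.cong)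
  then have "(\<Sum>v\<in>{1..n}. real (outdeg t v)) = real n - 1"
    using assms by (auto simp: proper_tree_def of_nat_diff simp flip: of_nat_sum)
  then show ?thesis
    using assms by (simp add: proper_tree_def weight_def sum_subtractf flip: sum_divide_distrib)
qed

lemma pmf_parent_pmf_proper:
  assumes "proper_tree d n t" "n \<ge> 1" "d \<ge> 2"
  shows "pmf (parent_pmf d t) v =
           (if v \<in> verts t then weight d t v / (\<Sum>u\<in>verts t. weight d t u) else 0)"
proof -
  let ?Z = "\<Sum>u\<in>verts t. weight d t u"
  let ?f = "\<lambda>v. if v \<in> verts t then weight d t v / ?Z else 0"
  have nn: "weight d t v \<ge> 0" for v
    using assms by (auto simp: weight_def proper_tree_def divide_le_eq_1)
  have "(real n - 1) / real d \<le> real n - 1"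
    using assms by (simp add: divide_le_eq mult_left_mono[of 1 "real d" "real n - 1", simplified])
  then have Z: "?Z > 0" using sum_weight[OF assms(1,2)] by linarith
  have fin: "finite (verts t)" using assms by (auto simp: proper_tree_def)
  have f0: "?f v \<ge> 0" for v using nn Z by auto
  have "(\<integral>\<^sup>+ v. ennreal (?f v) \<partial>count_space UNIV) = (\<Sum>v\<in>verts t. ennreal (?f v))"
    by (rule nn_integral_count_space'[OF fin]) auto
  also have "\<dots> = ennreal (\<Sum>v\<in>verts t. ?f v)"
    using nn Z by (intro sum_ennreal) auto
  also have "(\<Sum>v\<in>verts t. ?f v) = 1"
    using Z by (simp flip: sum_divide_distrib)
  finally show ?thesis
    unfolding parent_pmf_def using f0 by (subst pmf_embed_pmf) auto
qed

lemma proper_tree_pmf: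
  assumes "d \<ge> 2" "n \<ge> 1" "t \<in> set_pmf (tree_pmf d p n)"
  shows "proper_tree d n t"
  using assms(2,3)
proof (induction n arbitrary: t rule: nat_induct_at_least)
  case base
  then show ?case
    by (auto simp: proper_tree_def single_vertex_def outdeg_def)
next
  case (Suc n)
  obtain m where n: "n = Suc m"
    using Suc.hyps by (cases n) auto
  have "tree_pmf d p (Suc n) = bind_pmf (tree_pmf d p n) (grow d p)"
    by (simp only: n tree_pmf.simps)
  then obtain s where s: "s \<in> set_pmf (tree_pmf d p n)" and "t \<in> set_pmf (grow d p s)"
    using Suc.prems by auto
  then obtain v c where v: "v \<in> set_pmf (parent_pmf d s)" and t: "t = add_child s v c"
    unfolding grow_def set_bind_pmf set_return_pmf by blast
  have ps: "proper_tree d n s" using Suc.IH s by blast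
  have "pmf (parent_pmf d s) v \<noteq> 0" using v by (simp add: set_pmf_iff)
  then have vv: "v \<in> verts s" and w: "weight d s v \<noteq> 0"
    using pmf_parent_pmf_proper[OF ps Suc.hyps assms(1)] by (auto split: if_splits)
  then have lt: "outdeg s v < d"
    using ps assms(1) le_neq_implies_less[of "outdeg s v" d]
    by (auto simp: weight_def proper_tree_def)
  have new: "(x, Suc n) \<notin> edges s" for x
    using ps by (auto simp: proper_tree_def)
  have fin: "finite (edges s)"
    using ps finite_subset[of "edges s" "{1..n} \<times> {1..n}"] by (auto simp: proper_tree_def)
  have ed: "edges t = insert (v, Suc n) (edges s)" and ve: "verts t = {1..Suc n}"
    using ps by (auto simp: t add_child_def proper_tree_def Let_def)
  have "{w. (v, w) \<in> edges t} = insert (Suc n) {w. (v, w) \<in> edges s}"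
    by (auto simp: ed)
  moreover have "{w. (v, w) \<in> edges s} \<subseteq> {1..n}"
    using ps by (auto simp: proper_tree_def)
  then have "finite {w. (v, w) \<in> edges s}"
    by (rule finite_subset) simp
  ultimately have "outdeg t v = Suc (outdeg s v)"
    using new by (simp add: outdeg_def)
  moreover have "outdeg t u = outdeg s u" if "u \<noteq> v" for u
    using that by (simp add: outdeg_def ed)
  ultimately have "outdeg t u \<le> d" for u
    using lt ps by (cases "u = v") (auto simp: proper_tree_def)
  moreover have "card (edges t) = n"
    using new fin ps Suc.hyps by (simp add: ed proper_tree_def)
  moreover have "edges t \<subseteq> {1..Suc n} \<times> {1..Suc n}"
    using ps vv by (auto simp: ed proper_tree_def)
  ultimately show ?case using ve by (simp add: proper_tree_def)
qed

lemma pmf_parent_pmf: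
  assumes "d \<ge> 2" "n \<ge> 1" "t \<in> set_pmf (tree_pmf d p n)"
  shows "pmf (parent_pmf d t) v =
           (if v \<in> verts t then weight d t v / (\<Sum>u\<in>verts t. weight d t u) else 0)"
  using pmf_parent_pmf_proper[OF proper_tree_pmf[OF assms] assms(2,1)] .

end

theory Submission
  imports Defs
begin

text \<open>
  Give every vertex \<open>d\<close> slots, one of which is filled by each child. A new vertex then chooses a
  uniformly random open slot among the \<open>n * d - (n - 1)\<close> open slots of a tree with \<open>n\<close> vertices.
  Let \<open>w\<close> be the number of open slots of the root cluster and \<open>c\<close> its size. With
  \<open>T = n * (d - 1) + 1\<close>, the pair \<open>(w, c)\<close> is a Markov chain: it stays put with probability
  \<open>1 - w / T\<close>, and otherwise becomes \<open>(w + d - 1, c + 1)\<close> with probability \<open>p\<close> and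
  \<open>(w - 1, c)\<close> with probability \<open>1 - p\<close> (\<open>tree_mean_Suc\<close>).

  The moments of \<open>w\<close> come from exact eigenfunctions of this chain. Put \<open>a = p * d - 1\<close>. If a power
  series \<open>H\<close> with \<open>H(0) = 1\<close> solves \<open>a x H' = p H ^ d + (1 - p) - H\<close>, then differentiating
  \<open>H ^ w\<close> shows that the coefficient \<open>g k w\<close> of \<open>x ^ k\<close> in \<open>H ^ w\<close> satisfies
  \<open>w * (p * g k (w + d - 1) + (1 - p) * g k (w - 1) - g k w) = k * a * g k w\<close> (\<open>g_eigen\<close>).
  Hence each step multiplies the mean of \<open>g k w\<close> by \<open>1 + k * a / T\<close>, and the resulting product is a
  quotient of Gamma functions asymptotic to a multiple of \<open>n powr (k * \<gamma>)\<close>, where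
  \<open>\<gamma> = a / (d - 1)\<close>.

  The equation for \<open>H\<close> is the recursion for \<open>D\<close> in disguise. Partial Bell polynomials are
  coefficients of powers of the exponential generating function \<open>F\<close> of \<open>D\<close>
  (\<open>bell_poly_eq_power_coeff\<close>), so that \<open>H = 1 + p F\<close> is the solution. The same equation
  evaluates the starting value as \<open>g k d = (1 + k * a) * D k / k!\<close>.

  As a function of \<open>w\<close>, \<open>g k\<close> is a polynomial of degree \<open>k\<close> with leading coefficient
  \<open>(p / a) ^ k / k!\<close>. So all moments of \<open>(p / a) * w / n powr \<gamma>\<close> converge to the claimed limits.
  Since \<open>D k / k!\<close> grows at most geometrically (\<open>D_growth\<close>) while Gamma grows faster than any
  geometric sequence, these limits determine a distribution, and the method of moments yields
  weak convergence.

  It remains to replace \<open>(p / a) * w\<close> by \<open>c\<close>: the combination \<open>a * c - p * w\<close> is a martingale with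
  bounded increments that moves only when the cluster is hit, so its second moment is at most of order
  \<open>n powr \<gamma>\<close> and it vanishes after division by \<open>n powr \<gamma>\<close> (\<open>cluster_slots_difference\<close>).
\<close>

section \<open>Bell polynomials as coefficients of powers\<close>

text \<open>
  Powers over factorials turn the multinomial theorem into a product formula without
  multinomial coefficients, and the factors of that product are those of a Bell polynomial.
\<close>

definition divided_power :: "real fps \<Rightarrow> nat \<Rightarrow> real fps" where
  "divided_power f m = fps_const (1 / fact m) * f ^ m"

lemma divided_power_add:
  "divided_power (f + g) j = (\<Sum>a\<le>j. divided_power f a * divided_power g (j - a))"
proof -
  have "divided_power (f + g) j
      = (\<Sum>a\<le>j. fps_const (1 / fact j) * (of_nat (j choose a) * f ^ a * g ^ (j - a)))"
    unfolding divided_power_def binomial_ring sum_distrib_left ..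
  also have "\<dots> = (\<Sum>a\<le>j. divided_power f a * divided_power g (j - a))"
  proof (rule sum.cong[OF refl])
    fix a assume "a \<in> {..j}"
    then have "1 / fact j * real (j choose a) = 1 / fact a * (1 / fact (j - a))"
      by (simp add: binomial_fact)
    then have c: "fps_const (1 / fact j) * of_nat (j choose a)
        = fps_const (1 / fact a) * fps_const (1 / fact (j - a) :: real)"
      by (simp add: fps_of_nat[symmetric] del: fps_of_nat)
    have "fps_const (1 / fact j) * (of_nat (j choose a) * f ^ a * g ^ (j - a))
        = (fps_const (1 / fact j) * of_nat (j choose a)) * (f ^ a * g ^ (j - a))"
      by (simp only: mult.assoc)
    also have "\<dots> = divided_power f a * divided_power g (j - a)"
      unfolding c divided_power_def by (simp only: ac_simps)
    finally show "fps_const (1 / fact j) * (of_nat (j choose a) * f ^ a * g ^ (j - a))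
        = divided_power f a * divided_power g (j - a)" .
  qed
  finally show ?thesis .
qed

lemma finite_compositions:
  assumes "finite J"
  shows "finite {m \<in> J \<rightarrow>\<^sub>E (UNIV :: nat set). (\<Sum>i\<in>J. m i) = j}"
proof (rule finite_subset)
  show "{m \<in> J \<rightarrow>\<^sub>E UNIV. (\<Sum>i\<in>J. m i) = j} \<subseteq> J \<rightarrow>\<^sub>E {..j}"
  proof
    fix m assume m: "m \<in> {m \<in> J \<rightarrow>\<^sub>E (UNIV :: nat set). (\<Sum>i\<in>J. m i) = j}"
    have "m i \<le> j" if "i \<in> J" for i
      using m member_le_sum[OF that, of m] assms by auto
    then show "m \<in> J \<rightarrow>\<^sub>E {..j}"
      using m by (auto simp: PiE_iff)
  qed
qed (use assms in \<open>simp add: finite_PiE\<close>)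

text \<open>
  The multinomial theorem, by induction on \<open>I\<close>: the exponent families on \<open>insert i0 I\<close> are
  sorted by the exponent of \<open>i0\<close>, and each slice is handled by \<open>divided_power_add\<close>.
\<close>

lemma divided_power_sum:
  assumes "finite I"
  shows "divided_power (\<Sum>i\<in>I. y i) j =
    (\<Sum>m\<in>{m \<in> I \<rightarrow>\<^sub>E UNIV. (\<Sum>i\<in>I. m i) = j}. \<Prod>i\<in>I. divided_power (y i) (m i))"
  using assms
proof (induction I arbitrary: j)
  case empty
  show ?case
  proof (cases "j = 0")
    case True
    then have "{m \<in> {} \<rightarrow>\<^sub>E UNIV. (\<Sum>i\<in>{}. m i) = j} = {\<lambda>_. undefined :: nat}" by simp
    then show ?thesis using True by (simp only: sum.empty prod.empty) (simp add: divided_power_def)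
  next
    case False
    then have "{m \<in> {} \<rightarrow>\<^sub>E (UNIV :: nat set). (\<Sum>i\<in>{}. m i) = j} = {}" by simp
    then show ?thesis using False by (simp only: sum.empty prod.empty) (simp add: divided_power_def)
  qed
next
  case (insert i0 I)
  let ?P = "\<lambda>J j. {m \<in> J \<rightarrow>\<^sub>E (UNIV :: nat set). (\<Sum>i\<in>J. m i) = j}"
  define h where "h m = (\<Prod>i\<in>insert i0 I. divided_power (y i) (m i))" for m
  define Q where "Q = ?P (insert i0 I) j"
  have slice: "(\<Sum>m\<in>{m \<in> Q. m i0 = a}. h m)
      = divided_power (y i0) a * divided_power (\<Sum>i\<in>I. y i) (j - a)" if a: "a \<le> j" for a
  proof -
    have upd: "(\<Sum>i\<in>I. (m(i0 := b)) i) = (\<Sum>i\<in>I. m i)" for m :: "'a \<Rightarrow> nat" and b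
      using insert(2) by (intro sum.cong) auto
    have "(\<Sum>m\<in>{m \<in> Q. m i0 = a}. h m)
        = (\<Sum>m\<in>?P I (j - a). divided_power (y i0) a * (\<Prod>i\<in>I. divided_power (y i) (m i)))"
    proof (rule sum.reindex_bij_witness[of _ "\<lambda>m. m(i0 := a)" "\<lambda>m. m(i0 := undefined)"])
      fix m assume "m \<in> {m \<in> Q. m i0 = a}"
      then have m: "m \<in> insert i0 I \<rightarrow>\<^sub>E UNIV" "m i0 = a" "(\<Sum>i\<in>insert i0 I. m i) = j"
        unfolding Q_def by (simp_all only: mem_Collect_eq simp_thms)
      have s: "a + (\<Sum>i\<in>I. m i) = j" using m(3) unfolding sum.insert[OF insert(1,2)] m(2) .
      show "m(i0 := undefined, i0 := a) = m" using m(2) by (simp only: fun_upd_upd fun_upd_idem_iff)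
      have "m(i0 := undefined) \<in> I \<rightarrow>\<^sub>E UNIV"
        using insert(2) by (rule fun_upd_in_PiE) (rule m(1))
      moreover have "(\<Sum>i\<in>I. (m(i0 := undefined)) i) = j - a"
        by (rule trans[OF upd[of m undefined]]) (use s in linarith)
      ultimately show "m(i0 := undefined) \<in> ?P I (j - a)" by (simp only: mem_Collect_eq simp_thms)
      have "(\<Prod>i\<in>I. divided_power (y i) ((m(i0 := undefined)) i)) = (\<Prod>i\<in>I. divided_power (y i) (m i))"
        using insert(2) by (intro prod.cong) auto
      then show "divided_power (y i0) a * (\<Prod>i\<in>I. divided_power (y i) ((m(i0 := undefined)) i)) = h m"
        unfolding h_def prod.insert[OF insert(1,2)] m(2) by (simp only:)
    next
      fix m assume "m \<in> ?P I (j - a)"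
      then have m: "m \<in> I \<rightarrow>\<^sub>E UNIV" "(\<Sum>i\<in>I. m i) = j - a" by (simp_all only: mem_Collect_eq simp_thms)
      have "m i0 = undefined" using m(1) insert(2) by (rule PiE_arb)
      then show "m(i0 := a, i0 := undefined) = m" by (simp only: fun_upd_upd fun_upd_idem_iff)
      have "m(i0 := a) \<in> insert i0 I \<rightarrow>\<^sub>E UNIV"
        using m(1) by (intro PiE_fun_upd) auto
      moreover have "(\<Sum>i\<in>insert i0 I. (m(i0 := a)) i) = j"
      proof -
        have "(\<Sum>i\<in>insert i0 I. (m(i0 := a)) i) = a + (\<Sum>i\<in>I. (m(i0 := a)) i)"
          by (rule trans[OF sum.insert[OF insert(1,2)]]) (rule arg_cong2[of _ _ _ _ "(+)", OF fun_upd_same refl])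
        also have "\<dots> = a + (j - a)" by (rule arg_cong[OF trans[OF upd m(2)]])
        also have "\<dots> = j" using a by (rule le_add_diff_inverse)
        finally show ?thesis .
      qed
      ultimately show "m(i0 := a) \<in> {m \<in> Q. m i0 = a}"
        unfolding Q_def by (simp only: mem_Collect_eq simp_thms fun_upd_same)
    qed
    then show ?thesis by (simp add: insert.IH sum_distrib_left)
  qed
  have "divided_power (\<Sum>i\<in>insert i0 I. y i) j = (\<Sum>a\<le>j. \<Sum>m\<in>{m \<in> Q. m i0 = a}. h m)"
    using insert(1,2) by (simp add: divided_power_add slice)
  also have "\<dots> = (\<Sum>m\<in>Q. h m)"
  proof (rule sum.group[where g = "\<lambda>m. m i0"])
    show "finite Q" unfolding Q_def by (rule finite_compositions) (simp add: insert(1))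
    show "(\<lambda>m. m i0) ` Q \<subseteq> {..j}" using insert(1,2) by (auto simp: Q_def)
  qed simp
  finally show ?case by (simp only: h_def Q_def)
qed

text \<open>
  The exponential generating function without constant term: \<open>x 0\<close> is ignored, because the
  variables of a Bell polynomial start at index 1.
\<close>

definition egf :: "(nat \<Rightarrow> real) \<Rightarrow> real fps" where
  "egf x = Abs_fps (\<lambda>i. if i = 0 then 0 else x i / fact i)"

lemma egf_nth_0 [simp]: "fps_nth (egf x) 0 = 0"
  by (simp add: egf_def)

text \<open>
  In a product of \<open>j\<close> coefficients with total index \<open>k\<close> and all indices positive, no index
  exceeds \<open>k - j + 1\<close>; this is why a Bell polynomial has only that many variables.
\<close>

lemma fps_nth_power_cong:
  fixes f g :: "'a :: comm_ring_1 fps"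
  assumes "fps_nth f 0 = 0" "fps_nth g 0 = 0" "j \<ge> 1"
    and "\<And>i. i \<le> k - j + 1 \<Longrightarrow> fps_nth f i = fps_nth g i"
  shows "fps_nth (f ^ j) k = fps_nth (g ^ j) k"
  using assms(3,4)
proof (induction j arbitrary: k rule: nat_induct_at_least)
  case base
  then show ?case by (cases k) auto
next
  case (Suc j)
  have "fps_nth f i * fps_nth (f ^ j) (k - i) = fps_nth g i * fps_nth (g ^ j) (k - i)"
    if i: "i \<le> k" for i
  proof (cases "i = 0 \<or> k - i < j")
    case True
    then show ?thesis
      using assms(1,2) startsby_zero_power_prefix[of f j] startsby_zero_power_prefix[of g j] by auto
  next
    case False
    have "fps_nth (f ^ j) (k - i) = fps_nth (g ^ j) (k - i)"
      using False Suc.hyps i by (intro Suc.IH Suc.prems) linarith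
    moreover have "fps_nth f i = fps_nth g i"
      using False Suc.hyps i by (intro Suc.prems) linarith
    ultimately show ?thesis by simp
  qed
  then show ?case by (simp add: fps_mult_nth)
qed

text \<open>
  The exponential formula. Expanding the divided power of
  \<open>\<Sum>i. (x i / i!) X ^ i\<close> gives the products in the definition of the Bell polynomial, and taking
  the coefficient of \<open>X ^ k\<close> imposes the condition on the weighted sum of the exponents.
\<close>

lemma bell_poly_eq_power_coeff:
  assumes j: "1 \<le> j" "j \<le> k"
  shows "bell_poly k j x = fact k / fact j * fps_nth (egf x ^ j) k"
proof -
  define I where "I = {1..k - j + 1}"
  define y where "y i = fps_const (x i / fact i) * fps_X ^ i" for i
  have ynth: "fps_nth (y i) n = (if n = i then x i / fact i else 0)" for i n
    by (simp add: y_def)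
  have "fps_nth (egf x ^ j) k = fps_nth ((\<Sum>i\<in>I. y i) ^ j) k"
  proof (rule fps_nth_power_cong)
    show "fps_nth (sum y I) 0 = 0"
      by (auto simp: fps_sum_nth ynth I_def intro!: sum.neutral)
    show "fps_nth (egf x) i = fps_nth (sum y I) i" if "i \<le> k - j + 1" for i
      using that by (simp add: fps_sum_nth ynth egf_def I_def)
  qed (use j in auto)
  then have "fps_nth (egf x ^ j) k / fact j = fps_nth (divided_power (sum y I) j) k"
    by (simp add: divided_power_def)
  also have "\<dots> = (\<Sum>m\<in>{m \<in> I \<rightarrow>\<^sub>E UNIV. (\<Sum>i\<in>I. m i) = j}.
      fps_nth (\<Prod>i\<in>I. divided_power (y i) (m i)) k)"
    by (subst divided_power_sum) (auto simp: I_def fps_sum_nth)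
  also have "\<dots> = (\<Sum>m\<in>{m \<in> I \<rightarrow>\<^sub>E UNIV. (\<Sum>i\<in>I. m i) = j}.
      if (\<Sum>i\<in>I. i * m i) = k then (\<Prod>i\<in>I. x i ^ m i / (fact (m i) * fact i ^ m i)) else 0)"
  proof (rule sum.cong[OF refl])
    fix m
    let ?c = "\<lambda>i. x i ^ m i / (fact (m i) * fact i ^ m i)"
    have dp: "divided_power (y i) (m i) = fps_const (?c i) * fps_X ^ (i * m i)" for i
      unfolding divided_power_def y_def
      by (simp add: power_mult_distrib fps_const_power power_divide field_simps flip: power_mult)
    have "(\<Prod>i\<in>J. divided_power (y i) (m i)) = fps_const (\<Prod>i\<in>J. ?c i) * fps_X ^ (\<Sum>i\<in>J. i * m i)"
      if "finite J" for J
      using that by induction (simp_all add: dp power_add flip: fps_const_mult)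
    from this[of I] have "(\<Prod>i\<in>I. divided_power (y i) (m i))
        = fps_const (\<Prod>i\<in>I. ?c i) * fps_X ^ (\<Sum>i\<in>I. i * m i)"
      by (simp add: I_def)
    then show "fps_nth (\<Prod>i\<in>I. divided_power (y i) (m i)) k
        = (if (\<Sum>i\<in>I. i * m i) = k then (\<Prod>i\<in>I. ?c i) else 0)"
      by simp
  qed
  also have "\<dots> = (\<Sum>m\<in>bell_index k j. \<Prod>i\<in>I. x i ^ m i / (fact (m i) * fact i ^ m i))"
  proof -
    have fin: "finite {m \<in> I \<rightarrow>\<^sub>E (UNIV :: nat set). (\<Sum>i\<in>I. m i) = j}"
      by (rule finite_compositions) (simp add: I_def)
    show ?thesis
      unfolding sum.inter_filter[OF fin, symmetric]
      by (rule sum.cong) (auto simp: bell_index_def I_def)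
  qed
  finally have e: "(\<Sum>m\<in>bell_index k j. \<Prod>i\<in>I. x i ^ m i / (fact (m i) * fact i ^ m i))
      = fps_nth (egf x ^ j) k / fact j" by (rule sym)
  show ?thesis
    unfolding bell_poly_def sum_distrib_left[symmetric] e[unfolded I_def] by simp
qed

lemma bell_poly_cong:
  assumes "\<And>i. 1 \<le> i \<Longrightarrow> i \<le> k - j + 1 \<Longrightarrow> x i = y i"
  shows "bell_poly k j x = bell_poly k j y"
  unfolding bell_poly_def using assms
  by (intro sum.cong prod.cong arg_cong2[where f = "(*)"] refl) simp

lemma bell_poly_nonneg:
  assumes "\<And>i. 1 \<le> i \<Longrightarrow> i \<le> k - j + 1 \<Longrightarrow> x i \<ge> 0"
  shows "bell_poly k j x \<ge> 0"
  unfolding bell_poly_def using assms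
  by (intro sum_nonneg mult_nonneg_nonneg prod_nonneg divide_nonneg_nonneg zero_le_power ballI) simp_all

section \<open>Truncated powers of a power series with nonnegative coefficients\<close>

text \<open>
  Both factors lack a constant term, so a product term of index at most \<open>N + 1\<close> only uses
  coefficients of index at most \<open>N\<close>. The gain of one index drives the induction in
  \<open>D_growth\<close>.
\<close>

lemma sum_mult_coeffs_le:
  fixes f g :: "real fps"
  assumes "fps_nth f 0 = 0" "fps_nth g 0 = 0"
    and f: "\<And>i. fps_nth f i \<ge> 0" and g: "\<And>i. fps_nth g i \<ge> 0" and r: "r \<ge> 0"
  shows "(\<Sum>k\<le>Suc N. fps_nth (f * g) k * r ^ k)
    \<le> (\<Sum>k\<le>N. fps_nth f k * r ^ k) * (\<Sum>k\<le>N. fps_nth g k * r ^ k)"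
proof -
  define t where "t i j = fps_nth f i * fps_nth g j * r ^ (i + j)" for i j
  have t0: "t i j \<ge> 0" for i j using f g r by (simp add: t_def)
  have "(\<Sum>k\<le>Suc N. fps_nth (f * g) k * r ^ k) = (\<Sum>k\<le>Suc N. \<Sum>i\<le>k. t i (k - i))"
    unfolding fps_mult_nth sum_distrib_right t_def by (intro sum.cong) (auto simp: atMost_atLeast0)
  also have "\<dots> = (\<Sum>(i, j)\<in>{(i, j). i + j \<le> Suc N}. t i j)"
    by (rule sum.triangle_reindex_eq[symmetric])
  also have "\<dots> = (\<Sum>(i, j)\<in>{(i, j). i + j \<le> Suc N \<and> i \<noteq> 0 \<and> j \<noteq> 0}. t i j)"
  proof (rule sum.mono_neutral_right)
    show "finite {(i, j). i + j \<le> Suc N}"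
      by (rule finite_subset[of _ "{..Suc N} \<times> {..Suc N}"]) auto
  qed (use assms(1,2) in \<open>auto simp: t_def intro!: gr0I\<close>)
  also have "\<dots> \<le> (\<Sum>(i, j)\<in>{..N} \<times> {..N}. t i j)"
    using t0 by (intro sum_mono2) auto
  also have "\<dots> = (\<Sum>k\<le>N. fps_nth f k * r ^ k) * (\<Sum>k\<le>N. fps_nth g k * r ^ k)"
    unfolding sum_product sum.cartesian_product t_def
    by (intro sum.cong) (auto simp: power_add)
  finally show ?thesis .
qed

lemma fps_power_nonneg:
  fixes f :: "real fps"
  assumes "\<And>i. fps_nth f i \<ge> 0"
  shows "fps_nth (f ^ j) i \<ge> 0"
proof (induction j arbitrary: i)
  case 0
  then show ?case by simp
next
  case (Suc j)
  then show ?case using assms by (auto simp: fps_mult_nth intro!: sum_nonneg)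
qed

lemma sum_power_coeffs_le:
  fixes f :: "real fps"
  assumes f0: "fps_nth f 0 = 0" and f: "\<And>i. fps_nth f i \<ge> 0" and r: "r \<ge> 0" and j: "j \<ge> 2"
  shows "(\<Sum>k\<le>Suc N. fps_nth (f ^ j) k * r ^ k) \<le> (\<Sum>k\<le>N. fps_nth f k * r ^ k) ^ j"
  using j
proof (induction j rule: nat_induct_at_least)
  case base
  then show ?case
    using sum_mult_coeffs_le[OF f0 f0 f f r] by (simp add: power2_eq_square)
next
  case (Suc j)
  have z: "fps_nth (f ^ j) 0 = 0" using f0 Suc.hyps by (simp add: fps_nth_power_0)
  have S: "0 \<le> (\<Sum>k\<le>N. fps_nth f k * r ^ k)" using f r by (auto intro!: sum_nonneg)
  have "(\<Sum>k\<le>Suc N. fps_nth (f ^ Suc j) k * r ^ k)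
      \<le> (\<Sum>k\<le>N. fps_nth f k * r ^ k) * (\<Sum>k\<le>N. fps_nth (f ^ j) k * r ^ k)"
    using sum_mult_coeffs_le[OF f0 z f fps_power_nonneg[OF f] r] by simp
  also have "\<dots> \<le> (\<Sum>k\<le>N. fps_nth f k * r ^ k) * (\<Sum>k\<le>N. fps_nth f k * r ^ k) ^ j"
  proof (rule mult_left_mono[OF _ S])
    have "(\<Sum>k\<le>N. fps_nth (f ^ j) k * r ^ k) \<le> (\<Sum>k\<le>Suc N. fps_nth (f ^ j) k * r ^ k)"
      using fps_power_nonneg[OF f] r by simp
    then show "(\<Sum>k\<le>N. fps_nth (f ^ j) k * r ^ k) \<le> (\<Sum>k\<le>N. fps_nth f k * r ^ k) ^ j"
      using Suc.IH by linarith
  qed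
  finally show ?case by simp
qed

section \<open>The generating function of the moment coefficients\<close>

text \<open>
  The numbers \<open>D k\<close>. The guard \<open>i < k\<close> makes the recursion well-founded and changes nothing, as
  a Bell polynomial with \<open>j \<ge> 2\<close> reads no argument of index \<open>k\<close> or more. The value 1 at
  \<open>k = 0\<close> makes the formula for the limit moments correct for \<open>k = 0\<close> too.
\<close>

function (sequential) moment_coeff :: "nat \<Rightarrow> real \<Rightarrow> nat \<Rightarrow> real" where
  "moment_coeff d p k =
    (if k = 0 then 1 else if k = 1 then 1 / (p * real d - 1) else
      (\<Sum>j=2..min k d. p ^ j * fact d / fact (d - j) *
         bell_poly k j (\<lambda>i. if i < k then moment_coeff d p i else 0)) /
      ((real k - 1) * (p * real d - 1)))"
  by pat_completeness auto
termination by (relation "Wellfounded.measure (\<lambda>(d, p, k). k)") simp_all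

declare moment_coeff.simps [simp del]

locale broadcasting =
  fixes d :: nat and p :: real
  assumes d: "d \<ge> 2" and p0: "0 \<le> p" and p1: "p \<le> 1" and pd: "p > 1 / real d"
begin

text \<open>
  The mean change of the number of open slots of the cluster when one of them is used:
  \<open>p * (d - 1) - (1 - p)\<close>.
\<close>

definition a :: real where "a = p * real d - 1"

lemma a_pos: "a > 0"
  using pd d by (simp add: a_def field_simps)

lemma p_pos: "p > 0"
  using pd d by (smt (verit) of_nat_0_le_iff zero_le_divide_1_iff)

abbreviation D :: "nat \<Rightarrow> real" where "D \<equiv> moment_coeff d p"

lemma D_0 [simp]: "D 0 = 1" and D_1: "D 1 = 1 / a"
  by (simp_all add: moment_coeff.simps a_def)

lemma D_rec:
  assumes "k \<ge> 2"
  shows "(real k - 1) * a * D k = (\<Sum>j=2..min k d. p ^ j * fact d / fact (d - j) * bell_poly k j D)"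
proof -
  have "(\<Sum>j=2..min k d. p ^ j * fact d / fact (d - j) *
         bell_poly k j (\<lambda>i. if i < k then D i else 0))
      = (\<Sum>j=2..min k d. p ^ j * fact d / fact (d - j) * bell_poly k j D)"
    using assms by (intro sum.cong arg_cong2[where f = "(*)"] refl bell_poly_cong) auto
  then have "D k = (\<Sum>j=2..min k d. p ^ j * fact d / fact (d - j) * bell_poly k j D)
      / ((real k - 1) * a)"
    using assms by (subst moment_coeff.simps) (simp add: a_def)
  then show ?thesis using assms a_pos by simp
qed

lemma D_nonneg: "D k \<ge> 0"
proof (induction k rule: less_induct)
  case (less k)
  consider "k = 0" | "k = 1" | "k \<ge> 2" by linarith
  then show ?case
  proof cases
    case 3
    have "0 \<le> (real k - 1) * a * D k"
      unfolding D_rec[OF 3] using p0 3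
      by (intro sum_nonneg mult_nonneg_nonneg bell_poly_nonneg less.IH) auto
    moreover have "(real k - 1) * a > 0" using 3 a_pos by simp
    ultimately show ?thesis by (simp add: zero_le_mult_iff)
  qed (use a_pos in \<open>simp_all add: D_1[unfolded One_nat_def]\<close>)
qed

definition F :: "real fps" where "F = egf D"

definition H :: "real fps" where "H = 1 + fps_const p * F"

lemma F_nth_0 [simp]: "fps_nth F 0 = 0" by (simp add: F_def)

lemma F_nth: "k \<ge> 1 \<Longrightarrow> fps_nth F k = D k / fact k"
  by (simp add: F_def egf_def)

lemma F_nonneg: "fps_nth F k \<ge> 0"
  by (cases k) (simp_all add: F_nth D_nonneg)

lemma H_nth_0 [simp]: "fps_nth H 0 = 1"
  by (simp add: H_def)

text \<open>
  The recursion for \<open>D\<close> divided by \<open>k!\<close>: the factor \<open>d! / (d - j)!\<close> and the \<open>j!\<close> of the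
  exponential formula combine to a binomial coefficient, as needed for
  \<open>(1 + p F) ^ d\<close>.
\<close>

lemma F_recursion:
  assumes "k \<ge> 2"
  shows "(real k - 1) * a * fps_nth F k = (\<Sum>j=2..d. real (d choose j) * p ^ j * fps_nth (F ^ j) k)"
proof -
  have "(real k - 1) * a * fps_nth F k = (real k - 1) * a * D k / fact k"
    using assms by (simp add: F_nth)
  also have "\<dots> = (\<Sum>j=2..min k d. p ^ j * fact d / fact (d - j) * bell_poly k j D / fact k)"
    by (simp only: D_rec[OF assms] sum_divide_distrib)
  also have "\<dots> = (\<Sum>j=2..min k d. real (d choose j) * p ^ j * fps_nth (F ^ j) k)"
    by (intro sum.cong refl) (auto simp: bell_poly_eq_power_coeff F_def binomial_fact field_simps)
  also have "\<dots> = (\<Sum>j=2..d. real (d choose j) * p ^ j * fps_nth (F ^ j) k)"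
    by (rule sum.mono_neutral_left) (auto simp: startsby_zero_power_prefix)
  finally show ?thesis .
qed

lemma H_power_d:
  "fps_nth (H ^ d) k = (\<Sum>j\<le>d. real (d choose j) * p ^ j * fps_nth (F ^ j) k)"
proof -
  have "H ^ d = (\<Sum>j\<le>d. fps_const (real (d choose j) * p ^ j) * F ^ j)"
    unfolding H_def add.commute[of 1] binomial_ring
    by (simp add: power_mult_distrib fps_const_power mult.assoc flip: fps_const_mult fps_of_nat)
  then show ?thesis by (simp add: fps_sum_nth)
qed

text \<open>
  For \<open>k \<ge> 2\<close> the terms \<open>j \<ge> 2\<close> of the binomial expansion sum to \<open>(k - 1) * a * D k / k!\<close> by
  the recursion, and the linear term adds \<open>(1 + a) * D k / k!\<close>. For \<open>k = 1\<close> only the linear term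
  is present, and \<open>d * p = 1 + a\<close>.
\<close>

lemma H_power_d_nth: "fps_nth (H ^ d) k = (1 + real k * a) * D k / fact k"
proof -
  have split: "fps_nth (H ^ d) k = fps_nth 1 k + real d * p * fps_nth F k
      + (\<Sum>j=2..d. real (d choose j) * p ^ j * fps_nth (F ^ j) k)"
  proof -
    have "{..d} = insert 0 (insert 1 {2..d})" using d by auto
    then show ?thesis by (simp add: H_power_d)
  qed
  consider "k = 0" | "k = 1" | "k \<ge> 2" by linarith
  then show ?thesis
  proof cases
    case 1
    then show ?thesis by (simp add: fps_nth_power_0)
  next
    case 2
    have "fps_nth (F ^ j) (Suc 0) = 0" if "2 \<le> j" for j
      using that by (simp add: startsby_zero_power_prefix)
    then have "fps_nth (H ^ d) k = real d * p * fps_nth F 1"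
      unfolding split unfolding 2 by simp
    then show ?thesis using 2 by (simp add: F_nth a_def)
  next
    case 3
    then have "fps_nth (H ^ d) k = (real d * p + (real k - 1) * a) * fps_nth F k"
      by (simp add: split flip: F_recursion) (simp add: algebra_simps)
    also have "real d * p + (real k - 1) * a = 1 + real k * a"
      by (simp add: a_def algebra_simps)
    finally show ?thesis using 3 by (simp add: F_nth)
  qed
qed

lemma F_ode: "fps_const a * (fps_X * fps_deriv F) = H ^ d - 1 - F"
proof (rule fps_ext)
  fix k
  show "fps_nth (fps_const a * (fps_X * fps_deriv F)) k = fps_nth (H ^ d - 1 - F) k"
    by (cases k) (simp_all add: H_power_d_nth F_nth field_simps del: of_nat_Suc fact_Suc)
qed

lemma H_ode: "fps_const a * (fps_X * fps_deriv H) = fps_const p * H ^ d + fps_const (1 - p) - H"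
proof -
  have "fps_const a * (fps_X * fps_deriv H) = fps_const p * (fps_const a * (fps_X * fps_deriv F))"
    by (simp add: H_def algebra_simps)
  also have "\<dots> = fps_const p * H ^ d - fps_const p - fps_const p * F"
    by (simp only: F_ode) (simp add: algebra_simps)
  also have "\<dots> = fps_const p * H ^ d + fps_const (1 - p) - H"
    by (simp add: H_def flip: fps_const_1_eq_1 fps_const_sub)
  finally show ?thesis .
qed

text \<open>
  For fixed \<open>k\<close>, an eigenfunction of the cluster chain in the number \<open>w\<close> of open slots.
\<close>

definition g :: "nat \<Rightarrow> nat \<Rightarrow> real" where "g k w = fps_nth (H ^ w) k"

text \<open>
  Compare coefficients in \<open>a x (H ^ w)' = w H ^ (w - 1) (a x H')\<close> and insert the differential
  equation of \<open>H\<close>. At \<open>w = 0\<close> the truncated \<open>w - 1\<close> is harmless because of the factor \<open>w\<close>.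
\<close>

lemma g_eigen:
  "real k * a * g k w = real w * (p * g k (w + d - 1) + (1 - p) * g k (w - 1) - g k w)"
proof (cases w)
  case 0
  then show ?thesis by (cases k) (simp_all add: g_def)
next
  case (Suc v)
  have "fps_const a * (fps_X * fps_deriv (H ^ w))
      = of_nat w * (H ^ v * (fps_const a * (fps_X * fps_deriv H)))"
    by (simp only: fps_deriv_power Suc diff_Suc_1 fps_of_nat) (simp only: ac_simps)
  also have "\<dots> = of_nat w * (fps_const p * H ^ (w + d - 1) + fps_const (1 - p) * H ^ v - H ^ w)"
    unfolding H_ode using Suc by (simp add: algebra_simps power_add)
  finally have "fps_nth (fps_const a * (fps_X * fps_deriv (H ^ w))) k
      = fps_nth (of_nat w * (fps_const p * H ^ (w + d - 1) + fps_const (1 - p) * H ^ v - H ^ w)) k"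
    by simp
  also have "fps_nth (fps_const a * (fps_X * fps_deriv (H ^ w))) k = real k * a * g k w"
    by (cases k) (simp_all add: g_def)
  also have "fps_nth (of_nat w * (fps_const p * H ^ (w + d - 1) + fps_const (1 - p) * H ^ v - H ^ w)) k
      = real w * (p * g k (w + d - 1) + (1 - p) * g k (w - 1) - g k w)"
    using Suc by (simp add: g_def flip: fps_of_nat)
  finally show ?thesis .
qed

lemma g_d: "g k d = (1 + real k * a) * D k / fact k"
  by (simp add: g_def H_power_d_nth)

lemma g_0: "g 0 w = 1"
  by (simp add: g_def fps_nth_power_0)

text \<open>
  With the logarithmic derivative \<open>\<psi> = x H' / H\<close>, whose expansion starts with \<open>(p / a) x\<close>, one
  has \<open>x (H ^ w)' = w \<psi> H ^ w\<close>. So \<open>k * g k w\<close> is \<open>w\<close> times a combination of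
  \<open>g 0 w, \<dots>, g (k - 1) w\<close>, which gives the degree and the leading coefficient by induction.
\<close>

lemma g_polynomial:
  "\<exists>q. degree q \<le> k \<and> coeff q k = (p / a) ^ k / fact k \<and> (\<forall>w. g k w = poly q (real w))"
proof -
  define \<psi> where "\<psi> = fps_X * fps_deriv H * inverse H"
  have \<psi>0: "fps_nth \<psi> 0 = 0" by (simp add: \<psi>_def)
  have \<psi>1: "fps_nth \<psi> 1 = p / a"
    by (simp add: \<psi>_def H_def F_nth D_1[unfolded One_nat_def] mult.assoc)
  have rec: "real k * g k w = real w * (\<Sum>i=1..k. fps_nth \<psi> i * g (k - i) w)" for k w
  proof -
    have "fps_X * fps_deriv (H ^ w) = of_nat w * (\<psi> * H ^ w)"
    proof (cases w)
      case (Suc v)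
      have "\<psi> * H ^ w = fps_X * fps_deriv H * (inverse H * H) * H ^ v"
        unfolding \<psi>_def Suc by (simp only: power_Suc ac_simps)
      then have "\<psi> * H ^ w = fps_X * fps_deriv H * H ^ v"
        by (simp add: inverse_mult_eq_1)
      then show ?thesis
        by (simp only: fps_deriv_power Suc diff_Suc_1 fps_of_nat) (simp only: ac_simps)
    qed simp
    then have "fps_nth (fps_X * fps_deriv (H ^ w)) k = fps_nth (of_nat w * (\<psi> * H ^ w)) k" by simp
    also have "fps_nth (fps_X * fps_deriv (H ^ w)) k = real k * g k w"
      by (cases k) (simp_all add: g_def)
    also have "fps_nth (of_nat w * (\<psi> * H ^ w)) k = real w * (\<Sum>i=0..k. fps_nth \<psi> i * g (k - i) w)"
      by (simp only: fps_of_nat[symmetric] fps_mult_left_const_nth) (simp add: fps_mult_nth g_def)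
    also have "(\<Sum>i=0..k. fps_nth \<psi> i * g (k - i) w) = (\<Sum>i=1..k. fps_nth \<psi> i * g (k - i) w)"
      by (rule sum.mono_neutral_right) (auto simp: \<psi>0 not_le)
    finally show ?thesis .
  qed
  show ?thesis
  proof (induction k rule: less_induct)
    case (less k)
    show ?case
    proof (cases k)
      case 0
      then show ?thesis by (intro exI[of _ 1]) (simp add: g_0)
    next
      case (Suc k')
      obtain q where q: "\<And>i. i < k \<Longrightarrow> degree (q i) \<le> i \<and> coeff (q i) i = (p / a) ^ i / fact i
          \<and> (\<forall>w. g i w = poly (q i) (real w))"
        using less.IH by metis
      define Q where "Q = smult (1 / real k) (pCons 0 (\<Sum>i=1..k. smult (fps_nth \<psi> i) (q (k - i))))"
      have "degree (\<Sum>i=1..k. smult (fps_nth \<psi> i) (q (k - i))) \<le> k'"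
      proof (rule degree_sum_le)
        fix i assume "i \<in> {1..k}"
        then have "degree (q (k - i)) \<le> k - i" "k - i \<le> k'" using q[of "k - i"] Suc by auto
        then show "degree (smult (fps_nth \<psi> i) (q (k - i))) \<le> k'"
          using degree_smult_le[of "fps_nth \<psi> i" "q (k - i)"] by linarith
      qed simp
      then have "degree Q \<le> k"
        unfolding Q_def Suc by (intro order_trans[OF degree_smult_le] order_trans[OF degree_pCons_le]) simp
      moreover have "coeff Q k = (p / a) ^ k / fact k"
      proof -
        have "coeff Q k = (\<Sum>i=1..k. fps_nth \<psi> i * coeff (q (k - i)) k') / real k"
          unfolding Q_def by (simp add: Suc coeff_sum)
        also have "(\<Sum>i=1..k. fps_nth \<psi> i * coeff (q (k - i)) k')
            = (\<Sum>i\<in>{1}. fps_nth \<psi> i * coeff (q (k - i)) k')"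
        proof (rule sum.mono_neutral_right)
          show "\<forall>i\<in>{1..k} - {1}. fps_nth \<psi> i * coeff (q (k - i)) k' = 0"
          proof
            fix i assume i: "i \<in> {1..k} - {1}"
            then have "degree (q (k - i)) < k'" using q[of "k - i"] Suc by force
            then show "fps_nth \<psi> i * coeff (q (k - i)) k' = 0" by (simp add: coeff_eq_0)
          qed
        qed (auto simp: Suc)
        also have "\<dots> = p / a * ((p / a) ^ k' / fact k')"
          using q[of k'] \<psi>1 Suc by simp
        finally show ?thesis by (simp add: Suc)
      qed
      moreover have "g k w = poly Q (real w)" for w
      proof -
        have "real k * g k w = real w * (\<Sum>i=1..k. fps_nth \<psi> i * poly (q (k - i)) (real w))"
          using q by (subst rec) (auto intro!: sum.cong)
        also have "\<dots> = real k * poly Q (real w)"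
          using Suc by (simp add: Q_def poly_sum)
        finally show ?thesis using Suc by simp
      qed
      ultimately show ?thesis by blast
    qed
  qed
qed

text \<open>
  The generating function \<open>F\<close> has a positive radius of convergence. With \<open>S N\<close> the partial sum
  of \<open>F\<close> at a small point \<open>r\<close>, the recursion gives \<open>a * S (N + 1) \<le> r + 2 ^ d * (S N)\<^sup>2\<close> as
  long as \<open>S N \<le> 1\<close>. For \<open>r = a * \<delta>\<close> with \<open>\<delta>\<close> small, the bound \<open>S N \<le> 2 * \<delta>\<close> reproduces
  itself, so all partial sums are bounded.
\<close>

lemma D_growth: "\<exists>B>0. \<forall>k. D k / fact k \<le> B ^ k"
proof -
  \<comment> \<open>The cap \<open>1 / 2\<close> keeps \<open>S N \<le> 1\<close>, so that higher powers are at most \<open>(S N)\<^sup>2\<close>;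
    the other bound makes \<open>2 ^ d * (2 * \<delta>)\<^sup>2 \<le> a * \<delta>\<close>.\<close>
  define \<delta> where "\<delta> = min (1 / 2) (a / (4 * 2 ^ d))"
  define r where "r = a * \<delta>"
  define S where "S N = (\<Sum>k\<le>N. fps_nth F k * r ^ k)" for N
  have \<delta>: "\<delta> > 0" "\<delta> \<le> 1 / 2" "4 * \<delta> * 2 ^ d \<le> a"
    using a_pos by (auto simp: \<delta>_def min_def field_simps)
  have r: "r > 0" using \<delta> a_pos by (simp add: r_def)
  have S0: "S N \<ge> 0" for N
    unfolding S_def using F_nonneg r by (intro sum_nonneg) simp
  have F1: "fps_nth F 1 * r = \<delta>"
    using a_pos D_1 by (simp add: F_nth r_def)
  have "S N \<le> 2 * \<delta>" for N
  proof (induction N)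
    case 0
    then show ?case using \<delta> by (simp add: S_def)
  next
    case (Suc N)
    have "a * (\<Sum>k=2..Suc N. fps_nth F k * r ^ k)
        \<le> (\<Sum>k=2..Suc N. \<Sum>j=2..d. real (d choose j) * p ^ j * fps_nth (F ^ j) k * r ^ k)"
      unfolding sum_distrib_left
    proof (rule sum_mono)
      fix k assume k: "k \<in> {2..Suc N}"
      have "1 * (a * fps_nth F k) \<le> (real k - 1) * (a * fps_nth F k)"
        using k a_pos F_nonneg by (intro mult_right_mono) auto
      also have "\<dots> = (\<Sum>j=2..d. real (d choose j) * p ^ j * fps_nth (F ^ j) k)"
        using F_recursion[of k] k by (simp add: mult.assoc)
      finally have "a * fps_nth F k * r ^ k
          \<le> (\<Sum>j=2..d. real (d choose j) * p ^ j * fps_nth (F ^ j) k) * r ^ k"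
        using r by (intro mult_right_mono) auto
      then show "a * (fps_nth F k * r ^ k)
          \<le> (\<Sum>j=2..d. real (d choose j) * p ^ j * fps_nth (F ^ j) k * r ^ k)"
        by (simp add: sum_distrib_right mult.assoc)
    qed
    also have "\<dots> = (\<Sum>j=2..d. real (d choose j) * p ^ j * (\<Sum>k=2..Suc N. fps_nth (F ^ j) k * r ^ k))"
      by (subst sum.swap) (simp only: sum_distrib_left mult.assoc)
    also have "\<dots> \<le> (\<Sum>j=2..d. real (d choose j) * (S N)\<^sup>2)"
    proof (rule sum_mono)
      fix j assume j: "j \<in> {2..d}"
      have "(\<Sum>k=2..Suc N. fps_nth (F ^ j) k * r ^ k) \<le> (\<Sum>k\<le>Suc N. fps_nth (F ^ j) k * r ^ k)"
        using fps_power_nonneg[OF F_nonneg] r by (intro sum_mono2) auto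
      also have "\<dots> \<le> S N ^ j"
        unfolding S_def using j r by (intro sum_power_coeffs_le F_nonneg) auto
      also have "\<dots> \<le> S N ^ 2"
        using j S0[of N] Suc \<delta> by (intro power_decreasing) auto
      finally have "p ^ j * (\<Sum>k=2..Suc N. fps_nth (F ^ j) k * r ^ k) \<le> 1 * (S N)\<^sup>2"
        using p0 p1 by (intro mult_mono power_le_one sum_nonneg mult_nonneg_nonneg fps_power_nonneg F_nonneg)
          (use r in auto)
      then show "real (d choose j) * p ^ j * (\<Sum>k=2..Suc N. fps_nth (F ^ j) k * r ^ k)
          \<le> real (d choose j) * (S N)\<^sup>2"
        by (simp only: mult.assoc) (intro mult_left_mono, auto)
    qed
    also have "\<dots> \<le> (\<Sum>j\<le>d. real (d choose j) * (S N)\<^sup>2)"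
      by (intro sum_mono2) auto
    also have "\<dots> = 2 ^ d * (S N)\<^sup>2"
      by (simp add: choose_row_sum flip: sum_distrib_right of_nat_sum)
    also have "\<dots> \<le> 2 ^ d * (2 * \<delta>)\<^sup>2"
      using Suc S0[of N] by (intro mult_left_mono power_mono) auto
    also have "\<dots> = (4 * \<delta> * 2 ^ d) * \<delta>" by (simp add: power2_eq_square)
    also have "\<dots> \<le> a * \<delta>" using \<delta> by (intro mult_right_mono) auto
    finally have "(\<Sum>k=2..Suc N. fps_nth F k * r ^ k) \<le> \<delta>" using a_pos by simp
    moreover have "S (Suc N) = fps_nth F 1 * r + (\<Sum>k=2..Suc N. fps_nth F k * r ^ k)"
    proof -
      have "{..Suc N} = insert 0 (insert 1 {2..Suc N})" by auto
      then show ?thesis by (simp add: S_def)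
    qed
    ultimately show ?case using F1 by simp
  qed
  then have S1: "S N \<le> 1" for N using \<delta> by (smt (verit) field_sum_of_halves)
  have "D k / fact k \<le> (1 / r) ^ k" for k
  proof (cases "k = 0")
    case False
    have "D k / fact k * r ^ k = fps_nth F k * r ^ k" using False by (simp add: F_nth)
    also have "\<dots> \<le> S k"
      unfolding S_def by (rule member_le_sum) (use F_nonneg r in auto)
    finally have "D k / fact k * r ^ k \<le> 1" using S1[of k] by linarith
    then show ?thesis using r by (simp add: field_simps power_one_over)
  qed simp
  then show ?thesis using r by (intro exI[of _ "1 / r"]) simp
qed

end

section \<open>The root cluster as a Markov chain\<close>

definition mono_edges :: "coloured_tree \<Rightarrow> (nat \<times> nat) set" where
  "mono_edges t = {(u, v) \<in> edges t \<union> (edges t)\<inverse>. colour_of t u = colour_of t v}"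

text \<open>
  Describing the cluster by reachability along monochromatic edges replaces the quantification
  over all connected subsets, and makes the effect of a new leaf computable.
\<close>

lemma root_cluster_eq_reachable:
  assumes root: "1 \<in> verts t" and e: "edges t \<subseteq> verts t \<times> verts t"
  shows "root_cluster t = (mono_edges t)\<^sup>* `` {1}"
proof
  show "root_cluster t \<subseteq> (mono_edges t)\<^sup>* `` {1}"
  proof
    fix x assume "x \<in> root_cluster t"
    then obtain S where S: "root_mono_subtree t S" "x \<in> S" by (auto simp: root_cluster_def)
    then have "(1, x) \<in> ((edges t \<union> (edges t)\<inverse>) \<inter> S \<times> S)\<^sup>*"
      by (auto simp: root_mono_subtree_def connected_in_def)
    moreover have "(edges t \<union> (edges t)\<inverse>) \<inter> S \<times> S \<subseteq> mono_edges t"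
      using S(1) by (auto simp: root_mono_subtree_def mono_edges_def)
    ultimately show "x \<in> (mono_edges t)\<^sup>* `` {1}"
      using rtrancl_mono by blast
  qed
next
  let ?S = "(mono_edges t)\<^sup>* `` {1}"
  let ?R = "(edges t \<union> (edges t)\<inverse>) \<inter> ?S \<times> ?S"
  have from_root: "(1, x) \<in> ?R\<^sup>* \<and> x \<in> verts t \<and> colour_of t x = colour_of t 1"
    if "(1, x) \<in> (mono_edges t)\<^sup>*" for x
    using that
  proof (induction rule: rtrancl_induct)
    case base
    then show ?case using root by auto
  next
    case (step y z)
    have "(y, z) \<in> ?R"
      using step.hyps rtrancl_into_rtrancl[OF step.hyps] by (auto simp: mono_edges_def)
    moreover have "z \<in> verts t" "colour_of t z = colour_of t y"
      using step.hyps(2) e by (auto simp: mono_edges_def)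
    ultimately show ?case
      using step.IH by (auto intro: rtrancl_into_rtrancl)
  qed
  have "sym ?R" by (auto simp: sym_def)
  then have "sym (?R\<^sup>*)" by (rule sym_rtrancl)
  then have "(u, v) \<in> ?R\<^sup>*" if "u \<in> ?S" "v \<in> ?S" for u v
    using that from_root by (meson Image_singleton_iff rtrancl_trans symD)
  then have "connected_in t ?S" unfolding connected_in_def by blast
  moreover have "?S \<subseteq> verts t" "1 \<in> ?S" "\<forall>v\<in>?S. colour_of t v = colour_of t 1"
    using from_root by blast+
  ultimately have "root_mono_subtree t ?S"
    unfolding root_mono_subtree_def by blast
  then show "?S \<subseteq> root_cluster t"
    unfolding root_cluster_def by blast
qed

lemma proper_treeD:
  assumes "proper_tree d n t" "n \<ge> 1"
  shows "verts t = {1..n}" "edges t \<subseteq> {1..n} \<times> {1..n}" "1 \<in> verts t"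
    "edges t \<subseteq> verts t \<times> verts t" "finite (verts t)" "finite (edges t)" "outdeg t v \<le> d"
proof -
  have *: "verts t = {1..n}" "edges t \<subseteq> {1..n} \<times> {1..n}" "outdeg t v \<le> d"
    using assms(1) unfolding proper_tree_def by blast+
  then show "verts t = {1..n}" "edges t \<subseteq> {1..n} \<times> {1..n}" "outdeg t v \<le> d"
    "edges t \<subseteq> verts t \<times> verts t" "finite (verts t)" "1 \<in> verts t"
    using assms(2) by simp_all
  show "finite (edges t)" by (rule finite_subset[OF *(2)]) simp
qed

lemma root_cluster_subset: "root_cluster t \<subseteq> verts t"
  by (auto simp: root_cluster_def root_mono_subtree_def)

lemma add_child_simps:
  assumes "proper_tree d n t" "n \<ge> 1"
  shows "verts (add_child t v c) = insert (Suc n) {1..n}"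
    "edges (add_child t v c) = insert (v, Suc n) (edges t)"
    "colour_of (add_child t v c) = (colour_of t)(Suc n := c)"
  using proper_treeD(1)[OF assms] by (simp_all add: add_child_def Let_def)

text \<open>
  The new vertex is a leaf, so it creates no connection between old vertices and joins the
  cluster exactly when its parent lies there and shares its colour.
\<close>

lemma root_cluster_add_child:
  assumes t: "proper_tree d n t" "n \<ge> 1" and v: "v \<in> verts t"
  shows "root_cluster (add_child t v c) =
    (if v \<in> root_cluster t \<and> c = colour_of t v then insert (Suc n) (root_cluster t) else root_cluster t)"
proof -
  let ?w = "Suc n" and ?t = "add_child t v c"
  note T = proper_treeD[OF t] and A = add_child_simps[OF t]
  define R where "R = mono_edges t"
  define S where "S = R\<^sup>* `` {1}"
  have vn: "v \<in> {1..n}" using v T by simp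
  have Rn: "R \<subseteq> {1..n} \<times> {1..n}"
    using T(2) by (auto simp: R_def mono_edges_def)
  have cl: "root_cluster t = S"
    using root_cluster_eq_reachable[OF T(3,4)] by (simp add: S_def R_def)
  have Sn: "S \<subseteq> {1..n}"
    using cl root_cluster_subset[of t] T(1) by simp
  have R': "mono_edges ?t = R \<union> (if c = colour_of t v then {(v, ?w), (?w, v)} else {})"
  proof -
    have old: "x \<noteq> ?w \<and> y \<noteq> ?w" if "(x, y) \<in> edges t" for x y
      using that T(2) by fastforce
    have "v \<noteq> ?w" using vn by simp
    then show ?thesis
      unfolding mono_edges_def R_def A by (auto dest: old)
  qed
  have cl': "root_cluster ?t = (mono_edges ?t)\<^sup>* `` {1}"
  proof (rule root_cluster_eq_reachable)
    show "1 \<in> verts ?t" using t(2) by (simp add: A)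
    show "edges ?t \<subseteq> verts ?t \<times> verts ?t" unfolding A using T(2) vn by blast
  qed
  have S1: "1 \<in> S" and SR: "R `` S \<subseteq> S"
    by (auto simp: S_def intro: rtrancl_into_rtrancl)
  have S_sub: "S \<subseteq> (mono_edges ?t)\<^sup>* `` {1}"
    unfolding S_def R' by (rule Image_mono[OF rtrancl_mono[OF Un_upper1] subset_refl])
  show ?thesis
  proof (cases "v \<in> S \<and> c = colour_of t v")
    case True
    let ?T = "insert ?w S"
    have "mono_edges ?t = R \<union> {(v, ?w), (?w, v)}" using True R' by simp
    then have "mono_edges ?t `` ?T \<subseteq> ?T"
      using True SR Rn by auto
    then have "(mono_edges ?t)\<^sup>* `` ?T = ?T" by (rule Image_closed_trancl)
    then have "(mono_edges ?t)\<^sup>* `` {1} \<subseteq> ?T" using S1 by blast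
    moreover have "?w \<in> (mono_edges ?t)\<^sup>* `` {1}"
    proof -
      have "(1, v) \<in> (mono_edges ?t)\<^sup>*" using True S_sub by blast
      moreover have "(v, ?w) \<in> mono_edges ?t" unfolding R' using True by simp
      ultimately show ?thesis by (auto intro: rtrancl_into_rtrancl)
    qed
    ultimately show ?thesis using True S_sub cl cl' by auto
  next
    case False
    have "mono_edges ?t `` S \<subseteq> S"
      using False SR Rn Sn by (auto simp: R' split: if_splits)
    then have "(mono_edges ?t)\<^sup>* `` S = S" by (rule Image_closed_trancl)
    then have "(mono_edges ?t)\<^sup>* `` {1} \<subseteq> S" using S1 by blast
    then show ?thesis using False S_sub cl cl' by auto
  qed
qed

lemma outdeg_add_child:
  assumes t: "proper_tree d n t" "n \<ge> 1" and v: "v \<in> verts t"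
  shows "outdeg (add_child t v c) u = outdeg t u + (if u = v then 1 else 0)"
proof -
  note T = proper_treeD[OF t] and A = add_child_simps[OF t]
  have "{w. (u, w) \<in> edges (add_child t v c)}
      = (if u = v then insert (Suc n) {w. (u, w) \<in> edges t} else {w. (u, w) \<in> edges t})"
    by (auto simp: A)
  moreover have "{w. (u, w) \<in> edges t} \<subseteq> {1..n}" using T(2) by auto
  then have "finite {w. (u, w) \<in> edges t}" "Suc n \<notin> {w. (u, w) \<in> edges t}"
    using finite_subset by auto
  ultimately show ?thesis
    unfolding outdeg_def by (cases "u = v") (simp_all only: if_True if_False card_insert_disjoint, simp_all)
qed

definition cluster_size :: "coloured_tree \<Rightarrow> nat" where
  "cluster_size t = card (root_cluster t)"

text \<open>
  The number of children that the vertices of the cluster can still receive. Up to the factor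
  \<open>d\<close> it is the total attachment weight of the cluster.
\<close>

definition open_slots :: "nat \<Rightarrow> coloured_tree \<Rightarrow> nat" where
  "open_slots d t = (\<Sum>v\<in>root_cluster t. d - outdeg t v)"

text \<open>
  A new vertex of the cluster fills one slot and brings \<open>d\<close>; a child of the other colour only
  fills one.
\<close>

lemma cluster_step:
  assumes t: "proper_tree d n t" "n \<ge> 1" and v: "v \<in> verts t" and lt: "outdeg t v < d"
  shows "v \<in> root_cluster t \<Longrightarrow> c = colour_of t v \<Longrightarrow>
      cluster_size (add_child t v c) = cluster_size t + 1 \<and>
      open_slots d (add_child t v c) = open_slots d t + d - 1"
    "v \<in> root_cluster t \<Longrightarrow> c \<noteq> colour_of t v \<Longrightarrow>
      cluster_size (add_child t v c) = cluster_size t \<and>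
      open_slots d (add_child t v c) = open_slots d t - 1"
    "v \<notin> root_cluster t \<Longrightarrow>
      cluster_size (add_child t v c) = cluster_size t \<and>
      open_slots d (add_child t v c) = open_slots d t"
proof -
  note T = proper_treeD[OF t] and A = root_cluster_add_child[OF t v] and O = outdeg_add_child[OF t v]
  have fin: "finite (root_cluster t)" and new: "Suc n \<notin> root_cluster t"
    using finite_subset[OF root_cluster_subset[of t] T(5)] root_cluster_subset[of t] T(1) by auto
  have new_deg: "outdeg t (Suc n) = 0"
  proof -
    have "{w. (Suc n, w) \<in> edges t} = {}" using T(2) by auto
    then show ?thesis by (simp add: outdeg_def)
  qed
  have vn: "v \<noteq> Suc n" using v T(1) by auto
  have rest: "(\<Sum>u\<in>root_cluster t. d - outdeg (add_child t v c) u) = open_slots d t - 1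
      \<and> open_slots d t \<ge> 1" if "v \<in> root_cluster t"
  proof -
    have "(\<Sum>u\<in>root_cluster t - {v}. d - outdeg (add_child t v c) u) = (\<Sum>u\<in>root_cluster t - {v}. d - outdeg t u)"
      by (intro sum.cong) (auto simp: O)
    then show ?thesis
      unfolding open_slots_def sum.remove[OF fin that] using lt by (simp add: O)
  qed
  show "cluster_size (add_child t v c) = cluster_size t + 1 \<and>
      open_slots d (add_child t v c) = open_slots d t + d - 1"
    if "v \<in> root_cluster t" "c = colour_of t v"
  proof -
    have "root_cluster (add_child t v c) = insert (Suc n) (root_cluster t)" using that A by simp
    then show ?thesis
      using rest[OF that(1)] fin new vn lt
      by (simp add: cluster_size_def open_slots_def O new_deg)
  qed
  show "cluster_size (add_child t v c) = cluster_size t \<and>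
      open_slots d (add_child t v c) = open_slots d t - 1"
    if "v \<in> root_cluster t" "c \<noteq> colour_of t v"
  proof -
    have "root_cluster (add_child t v c) = root_cluster t" using that A by simp
    then show ?thesis
      using rest[OF that(1)] by (simp add: cluster_size_def open_slots_def)
  qed
  show "cluster_size (add_child t v c) = cluster_size t \<and>
      open_slots d (add_child t v c) = open_slots d t"
    if "v \<notin> root_cluster t"
  proof -
    have "root_cluster (add_child t v c) = root_cluster t" using that A by simp
    moreover have "outdeg (add_child t v c) u = outdeg t u" if "u \<in> root_cluster t" for u
      using that \<open>v \<notin> root_cluster t\<close> by (auto simp: O)
    ultimately show ?thesis by (simp add: cluster_size_def open_slots_def)
  qed
qed

lemma opposite_neq: "opposite c \<noteq> c"
  by (cases c) auto

text \<open>
  The number \<open>n * d - (n - 1)\<close> of open slots of a tree with \<open>n\<close> vertices.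
\<close>

definition total_slots :: "nat \<Rightarrow> nat \<Rightarrow> real" where
  "total_slots d n = real n * (real d - 1) + 1"

text \<open>
  The transition of the chain. Full vertices are chosen with probability 0 and the vertices of
  the cluster with total probability \<open>open_slots d t / total_slots d n\<close>, so that only membership
  of the parent in the cluster and the colour of the child matter.
\<close>

lemma expectation_grow:
  fixes f :: "nat \<Rightarrow> nat \<Rightarrow> real"
  assumes t: "proper_tree d n t" "n \<ge> 1" and d: "d \<ge> 2" and p: "0 \<le> p" "p \<le> 1"
  defines "w \<equiv> open_slots d t" and "c \<equiv> cluster_size t"
  shows "measure_pmf.expectation (grow d p t) (\<lambda>s. f (open_slots d s) (cluster_size s)) =
    f w c + real w / total_slots d n *
      (p * f (w + d - 1) (c + 1) + (1 - p) * f (w - 1) c - f w c)"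
proof -
  note T = proper_treeD[OF t] and P = pmf_parent_pmf_proper[OF t d]
  let ?h = "\<lambda>s. f (open_slots d s) (cluster_size s)"
  let ?A = "p * f (w + d - 1) (c + 1) + (1 - p) * f (w - 1) c"
  let ?q = "pmf (parent_pmf d t)"
  let ?child = "\<lambda>v same. add_child t v (if same then colour_of t v else opposite (colour_of t v))"
  have inner: "measure_pmf.expectation (bernoulli_pmf p \<bind> (\<lambda>same. return_pmf (?child v same))) ?h
      = p * ?h (?child v True) + (1 - p) * ?h (?child v False)" for v
    using p by (simp add: map_pmf_def[symmetric] mult.commute)
  have sup: "set_pmf (parent_pmf d t) \<subseteq> verts t"
    using P by (auto simp: set_pmf_iff split: if_splits)
  have step: "?q v * (p * ?h (?child v True) + (1 - p) * ?h (?child v False))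
      = ?q v * f w c + (if v \<in> root_cluster t then ?q v * (?A - f w c) else 0)" if v: "v \<in> verts t" for v
  proof (cases "outdeg t v < d")
    case False
    then have "outdeg t v = d" using T(7)[of v] by simp
    then have "?q v = 0" using d by (simp add: P weight_def)
    then show ?thesis by simp
  next
    case True
    note S = cluster_step[OF t v True]
    show ?thesis
    proof (cases "v \<in> root_cluster t")
      case in_cl: True
      show ?thesis
        using S(1)[OF in_cl refl] S(2)[OF in_cl opposite_neq] in_cl
        by (simp add: w_def c_def algebra_simps)
    next
      case False
      show ?thesis
        using S(3)[OF False] False by (simp add: w_def c_def algebra_simps)
    qed
  qed
  have "measure_pmf.expectation (grow d p t) ?h
      = (\<Sum>v\<in>verts t. ?q v * (p * ?h (?child v True) + (1 - p) * ?h (?child v False)))"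
    unfolding grow_def by (subst pmf_expectation_bind[OF T(5) _ sup]) (simp_all add: inner del: bind_return_pmf)
  also have "\<dots> = (\<Sum>v\<in>verts t. ?q v * f w c + (if v \<in> root_cluster t then ?q v * (?A - f w c) else 0))"
    by (intro sum.cong refl step)
  also have "\<dots> = (\<Sum>v\<in>verts t. ?q v) * f w c + (\<Sum>v\<in>root_cluster t. ?q v) * (?A - f w c)"
    using T(5) root_cluster_subset[of t]
    by (simp add: sum.distrib sum_distrib_right sum.inter_restrict[symmetric] Int_absorb1)
  also have "(\<Sum>v\<in>verts t. ?q v) = 1"
    using T(5) sup by (rule sum_pmf_eq_1)
  also have "(\<Sum>v\<in>root_cluster t. ?q v) = real w / total_slots d n"
  proof -
    have "(\<Sum>v\<in>root_cluster t. ?q v) = (\<Sum>v\<in>root_cluster t. real (d - outdeg t v) / total_slots d n)"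
    proof (rule sum.cong[OF refl])
      fix v assume "v \<in> root_cluster t"
      then have "?q v = (1 - real (outdeg t v) / real d) / (real n - (real n - 1) / real d)"
        using root_cluster_subset[of t] P[of v] unfolding sum_weight[OF t] by (auto simp: weight_def)
      also have "\<dots> = (real d - real (outdeg t v)) / total_slots d n"
      proof -
        have "1 - real (outdeg t v) / real d = (real d - real (outdeg t v)) / real d"
          "real n - (real n - 1) / real d = total_slots d n / real d"
          using d by (simp_all add: field_simps total_slots_def)
        then show ?thesis using d by simp
      qed
      finally show "?q v = real (d - outdeg t v) / total_slots d n"
        using T(7)[of v] by (simp add: of_nat_diff)
    qed
    then show ?thesis by (simp add: w_def open_slots_def sum_divide_distrib)
  qed
  finally show ?thesis by simp
qed

lemma finite_set_grow:
  assumes "proper_tree d n t" "n \<ge> 1" "d \<ge> 2"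
  shows "finite (set_pmf (grow d p t))"
proof -
  have "set_pmf (parent_pmf d t) \<subseteq> verts t"
    using pmf_parent_pmf_proper[OF assms] by (auto simp: set_pmf_iff split: if_splits)
  then have "finite (set_pmf (parent_pmf d t))"
    using proper_treeD(5)[OF assms(1,2)] finite_subset by blast
  then show ?thesis by (auto simp: grow_def)
qed

lemma tree_pmf_Suc: "n \<ge> 1 \<Longrightarrow> tree_pmf d p (Suc n) = bind_pmf (tree_pmf d p n) (grow d p)"
  by (cases n) simp_all

lemma finite_set_tree_pmf:
  assumes "d \<ge> 2"
  shows "finite (set_pmf (tree_pmf d p n))"
proof (induction n)
  case 0
  then show ?case by simp
next
  case (Suc n)
  show ?case
  proof (cases "n = 0")
    case False
    then show ?thesis
      using Suc finite_set_grow[OF proper_tree_pmf[OF assms]] assms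
      by (auto simp: tree_pmf_Suc)
  qed simp
qed

definition tree_mean :: "nat \<Rightarrow> real \<Rightarrow> nat \<Rightarrow> (nat \<Rightarrow> nat \<Rightarrow> real) \<Rightarrow> real" where
  "tree_mean d p n f = measure_pmf.expectation (tree_pmf d p n) (\<lambda>t. f (open_slots d t) (cluster_size t))"

lemma tree_mean_Suc:
  assumes d: "d \<ge> 2" and p: "0 \<le> p" "p \<le> 1" and n: "n \<ge> 1"
  shows "tree_mean d p (Suc n) f = tree_mean d p n (\<lambda>w c. f w c + real w / total_slots d n *
      (p * f (w + d - 1) (c + 1) + (1 - p) * f (w - 1) c - f w c))"
proof -
  have pr: "proper_tree d n t" if "t \<in> set_pmf (tree_pmf d p n)" for t
    using proper_tree_pmf[OF d n that] .
  note fin = finite_set_tree_pmf[OF d, of p n]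
  have "tree_mean d p (Suc n) f = (\<Sum>t\<in>set_pmf (tree_pmf d p n). pmf (tree_pmf d p n) t *
      measure_pmf.expectation (grow d p t) (\<lambda>s. f (open_slots d s) (cluster_size s)))"
    unfolding tree_mean_def tree_pmf_Suc[OF n]
    using finite_set_grow[OF pr n d]
    by (subst pmf_expectation_bind[OF fin]) auto
  also have "\<dots> = (\<Sum>t\<in>set_pmf (tree_pmf d p n). pmf (tree_pmf d p n) t *
      (let w = open_slots d t; c = cluster_size t in f w c + real w / total_slots d n *
      (p * f (w + d - 1) (c + 1) + (1 - p) * f (w - 1) c - f w c)))"
    by (intro sum.cong refl) (simp add: expectation_grow[OF pr n d p] Let_def)
  also have "\<dots> = tree_mean d p n (\<lambda>w c. f w c + real w / total_slots d n *
      (p * f (w + d - 1) (c + 1) + (1 - p) * f (w - 1) c - f w c))"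
    unfolding tree_mean_def
    by (subst integral_measure_pmf_real[OF fin]) (auto simp: Let_def mult.commute)
  finally show ?thesis .
qed

lemma tree_mean_1: "tree_mean d p 1 f = f d 1"
proof -
  have "root_cluster (single_vertex c) = {1}" for c
  proof -
    have "root_cluster (single_vertex c) = (mono_edges (single_vertex c))\<^sup>* `` {1}"
      by (rule root_cluster_eq_reachable) (auto simp: single_vertex_def)
    also have "mono_edges (single_vertex c) = {}" by (auto simp: mono_edges_def single_vertex_def)
    finally show ?thesis by simp
  qed
  then have "open_slots d (single_vertex c) = d" "cluster_size (single_vertex c) = 1" for c
    by (simp_all add: open_slots_def cluster_size_def outdeg_def) (simp add: single_vertex_def)
  then show ?thesis by (simp add: tree_mean_def)
qed

lemma tree_mean_add:
  "d \<ge> 2 \<Longrightarrow> tree_mean d p n (\<lambda>w c. f w c + f' w c) = tree_mean d p n f + tree_mean d p n f'"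
  unfolding tree_mean_def
  by (intro Bochner_Integration.integral_add integrable_measure_pmf_finite finite_set_tree_pmf)

lemma tree_mean_cmult: "tree_mean d p n (\<lambda>w c. r * f w c) = r * tree_mean d p n f"
  unfolding tree_mean_def by simp

lemma tree_mean_sum:
  "d \<ge> 2 \<Longrightarrow> tree_mean d p n (\<lambda>w c. \<Sum>i\<in>I. f i w c) = (\<Sum>i\<in>I. tree_mean d p n (f i))"
  unfolding tree_mean_def
  by (intro Bochner_Integration.integral_sum integrable_measure_pmf_finite finite_set_tree_pmf)

section \<open>Asymptotics of the Gamma function\<close>

text \<open>
  Keep only the interval \<open>[R, R + 1]\<close> of the Gamma integral. As \<open>R\<close> is arbitrary, this shows
  that Gamma outgrows every exponential.
\<close>

lemma Gamma_real_lower_bound: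
  fixes x R :: real
  assumes x: "x \<ge> 1" and R: "R > 0"
  shows "R powr (x - 1) * exp (- (R + 1)) \<le> Gamma x"
proof -
  define c where "c = R powr (x - 1) * exp (- (R + 1))"
  have "((\<lambda>t. if t \<in> {R..R + 1} then c else 0) has_integral c) {0..}"
    using has_integral_const_real[of c R "R + 1"] R
    by (subst has_integral_restrict) (auto simp: subset_iff)
  moreover have "((\<lambda>t. t powr (x - 1) / exp t) has_integral Gamma x) {0..}"
    using x by (intro Gamma_integral_real) simp
  ultimately have "c \<le> Gamma x"
  proof (rule has_integral_le)
    fix t :: real assume "t \<in> {0..}"
    show "(if t \<in> {R..R + 1} then c else 0) \<le> t powr (x - 1) / exp t"
    proof (cases "t \<in> {R..R + 1}")
      case True
      then have "c \<le> t powr (x - 1) * exp (- t)"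
        unfolding c_def using x R by (intro mult_mono powr_mono2) auto
      then show ?thesis using True by (simp add: exp_minus field_simps)
    qed auto
  qed
  then show ?thesis by (simp add: c_def)
qed

text \<open>
  Choosing \<open>R\<close> with \<open>R powr \<gamma> = 2 * y + 1\<close> in the lower bound for Gamma leaves the geometric
  sequence of ratio \<open>y / (2 * y + 1) < 1\<close>.
\<close>

lemma power_over_Gamma_tendsto_0:
  fixes b \<gamma> y :: real
  assumes b: "b > 0" and \<gamma>: "\<gamma> > 0" and y: "y \<ge> 0"
  shows "(\<lambda>k. y ^ k / Gamma (b + real k * \<gamma>)) \<longlonglongrightarrow> 0"
proof -
  define R where "R = (2 * y + 1) powr (1 / \<gamma>)"
  define K where "K = R powr (b - 1) * exp (- (R + 1))"
  have R: "R > 0" using y by (simp add: R_def)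
  have K: "K > 0" using R by (simp add: K_def)
  have R\<gamma>: "R powr (real k * \<gamma>) = (2 * y + 1) ^ k" for k
    using y \<gamma> by (simp add: R_def powr_powr powr_realpow)
  have ev: "\<forall>\<^sub>F k in sequentially. norm (y ^ k / Gamma (b + real k * \<gamma>)) \<le> (1 / K) * (y / (2 * y + 1)) ^ k"
    using eventually_ge_at_top[of "nat \<lceil>1 / \<gamma>\<rceil>"]
  proof eventually_elim
    case (elim k)
    then have "1 / \<gamma> \<le> real k" by linarith
    then have "b + real k * \<gamma> \<ge> 1" using b \<gamma> by (simp add: field_simps)
    from Gamma_real_lower_bound[OF this R]
    have G: "K * (2 * y + 1) ^ k \<le> Gamma (b + real k * \<gamma>)"
      unfolding R\<gamma>[symmetric] K_def using R
      by (simp add: mult_ac powr_add[symmetric] diff_add_eq)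
    have "K * (2 * y + 1) ^ k > 0" using K y by simp
    then have Gpos: "Gamma (b + real k * \<gamma>) > 0" using G by linarith
    have "y ^ k / Gamma (b + real k * \<gamma>) \<le> y ^ k / (K * (2 * y + 1) ^ k)"
      using G y K Gpos by (intro divide_left_mono mult_pos_pos) auto
    then show ?case using y Gpos by (simp add: power_divide)
  qed
  have "(\<lambda>k. (1 / K) * (y / (2 * y + 1)) ^ k) \<longlonglongrightarrow> (1 / K) * 0"
    using y by (intro tendsto_mult_left LIMSEQ_power_zero) (simp add: divide_less_eq)
  then have "(\<lambda>k. (1 / K) * (y / (2 * y + 1)) ^ k) \<longlonglongrightarrow> 0" by simp
  with ev show ?thesis by (rule Lim_null_comparison)
qed

text \<open>
  The quotient of two instances of Euler's limit formula for Gamma.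
\<close>

lemma pochhammer_ratio_asymptotics:
  fixes b c :: real
  assumes b: "b > 0" and c: "c \<ge> 0"
  shows "(\<lambda>n. pochhammer (b + c) n / pochhammer b n / real n powr c) \<longlonglongrightarrow> Gamma b / Gamma (b + c)"
proof -
  have "Gamma (b + c) > 0"
    using b c by (intro Gamma_real_pos) linarith
  then have "(\<lambda>n. Gamma_series' b n / Gamma_series' (b + c) n) \<longlonglongrightarrow> Gamma b / Gamma (b + c)"
    by (intro tendsto_divide Gamma_series'_LIMSEQ) simp
  moreover have "\<forall>\<^sub>F n in sequentially. Gamma_series' b n / Gamma_series' (b + c) n
      = pochhammer (b + c) n / pochhammer b n / real n powr c"
    using eventually_gt_at_top[of 0]
  proof eventually_elim
    case (elim n)
    have pos: "pochhammer b n > 0" "pochhammer (b + c) n > 0"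
      using b c by (auto intro!: pochhammer_pos)
    have "exp ((b + c) * ln (real n)) = exp (b * ln (real n)) * real n powr c"
      using elim by (simp add: powr_def algebra_simps exp_add)
    then show ?case
      using pos elim by (simp add: Gamma_series'_def field_simps)
  qed
  ultimately show ?thesis by (rule Lim_transform_eventually)
qed

section \<open>The method of moments\<close>

text \<open>
  Fatou's lemma for weak convergence: the truncations \<open>min R (x ^ (2 * k))\<close> are bounded and
  continuous, so their integrals pass to the limit, and monotone convergence removes \<open>R\<close>.
\<close>

lemma weak_limit_even_moment:
  fixes \<mu> :: "nat \<Rightarrow> real measure"
  assumes \<mu>: "\<And>n. real_distribution (\<mu> n)" and M: "real_distribution M"
    and w: "weak_conv_m \<mu> M"
    and int: "\<And>n. integrable (\<mu> n) (\<lambda>x. x ^ (2 * k))"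
    and B: "\<And>n. (LINT x|\<mu> n. x ^ (2 * k)) \<le> B"
  shows "integrable M (\<lambda>x. x ^ (2 * k))" "(LINT x|M. x ^ (2 * k)) \<le> B"
proof -
  interpret \<mu>: real_distribution "\<mu> n" for n by (rule \<mu>)
  interpret M: real_distribution M by (rule M)
  define f where "f R x = min (real R) (x ^ (2 * k))" for R and x :: real
  have f0: "0 \<le> f R x" "f R x \<le> real R" for R x
    by (auto simp: f_def)
  have cont: "isCont (f R) x" for R x
    unfolding f_def by (intro continuous_intros)
  have lim: "(\<lambda>n. LINT x|\<mu> n. f R x) \<longlonglongrightarrow> (LINT x|M. f R x)" for R
    using cont f0 by (intro weak_conv_imp_integral_bdd_continuous_conv[OF \<mu> M w, where B = "real R"]) auto
  have meas[measurable]: "f R \<in> borel_measurable borel" for R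
    unfolding f_def by measurable
  have le: "(LINT x|M. f R x) \<le> B" for R
  proof (rule LIMSEQ_le_const2[OF lim], intro exI allI impI)
    fix n :: nat
    have "(LINT x|\<mu> n. f R x) \<le> (LINT x|\<mu> n. x ^ (2 * k))"
      using int f0(1) by (intro integral_mono') (auto simp: f_def)
    then show "(LINT x|\<mu> n. f R x) \<le> B" using B[of n] by linarith
  qed
  have intf: "integrable M (f R)" for R
    using f0 by (intro M.integrable_const_bound[where B = "real R"]) auto
  have conv: "(\<lambda>R. f R x) \<longlonglongrightarrow> x ^ (2 * k)" for x
  proof (rule tendsto_eventually)
    show "\<forall>\<^sub>F R in sequentially. f R x = x ^ (2 * k)"
      using eventually_ge_at_top[of "nat \<lceil>x ^ (2 * k)\<rceil>"]
    proof eventually_elim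
      case (elim R)
      then have "x ^ (2 * k) \<le> real R" by linarith
      then show ?case by (simp add: f_def)
    qed
  qed
  have mono: "mono (\<lambda>R. f R x)" for x
    by (auto simp: mono_def f_def min_def)
  have "\<exists>L. (\<lambda>R. LINT x|M. f R x) \<longlonglongrightarrow> L"
  proof -
    have "incseq (\<lambda>R. LINT x|M. f R x)"
      using intf mono by (auto simp: incseq_def mono_def intro!: integral_mono)
    then show ?thesis
      using incseq_convergent[of "\<lambda>R. LINT x|M. f R x" B] le by metis
  qed
  then obtain L where L: "(\<lambda>R. LINT x|M. f R x) \<longlonglongrightarrow> L" by blast
  have bi: "has_bochner_integral M (\<lambda>x. x ^ (2 * k)) L"
    by (rule has_bochner_integral_monotone_convergence[OF intf _ _ L])
      (use mono conv f0 in auto)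
  then show "integrable M (\<lambda>x. x ^ (2 * k))" by (auto simp: has_bochner_integral_iff)
  have "L \<le> B" by (rule LIMSEQ_le_const2[OF L]) (use le in auto)
  then show "(LINT x|M. x ^ (2 * k)) \<le> B" using bi by (auto simp: has_bochner_integral_iff)
qed

lemma (in real_distribution) integrable_power_if_even:
  assumes "integrable M (\<lambda>x. x ^ (2 * k))"
  shows "integrable M (\<lambda>x. x ^ k)"
proof (rule Bochner_Integration.integrable_bound[where f = "\<lambda>x. 1 + x ^ (2 * k)"])
  show "AE x in M. norm (x ^ k) \<le> norm (1 + x ^ (2 * k))"
  proof (intro AE_I2)
    fix x :: real
    \<comment> \<open>From \<open>(\<bar>x ^ k\<bar> - 1)\<^sup>2 \<ge> 0\<close>.\<close>
    have "2 * \<bar>x ^ k\<bar> \<le> 1 + (x ^ k)\<^sup>2"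
      using zero_le_power2[of "\<bar>x ^ k\<bar> - 1"] by (simp add: power2_diff)
    moreover have "(x ^ k)\<^sup>2 = x ^ (2 * k)" by (simp add: power_mult mult.commute)
    ultimately show "norm (x ^ k) \<le> norm (1 + x ^ (2 * k))" by simp
  qed
qed (use assms in auto)

text \<open>
  The error of truncating at \<open>R\<close> is controlled by a moment of twice the order; this is the
  uniform integrability used to pass moments to a weak limit.
\<close>

lemma clamp_power_error:
  fixes x R :: real
  assumes "R > 0"
  shows "\<bar>x ^ k - (max (- R) (min R x)) ^ k\<bar> \<le> 2 * x ^ (2 * k) / R ^ k"
proof (cases "\<bar>x\<bar> \<le> R")
  case True
  then have "max (- R) (min R x) = x" by (auto simp: max_def min_def)
  then show ?thesis using assms by simp
next
  case False
  let ?c = "max (- R) (min R x)"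
  have "\<bar>?c\<bar> \<le> \<bar>x\<bar>" using False assms by (auto simp: max_def min_def)
  then have "\<bar>?c ^ k\<bar> \<le> \<bar>x\<bar> ^ k" unfolding power_abs by (intro power_mono) auto
  then have "\<bar>x ^ k - ?c ^ k\<bar> \<le> 2 * \<bar>x\<bar> ^ k" by (simp add: power_abs[symmetric])
  also have "\<bar>x\<bar> ^ k * R ^ k \<le> \<bar>x\<bar> ^ k * \<bar>x\<bar> ^ k"
    using False assms by (intro mult_left_mono power_mono) auto
  then have "2 * \<bar>x\<bar> ^ k \<le> 2 * x ^ (2 * k) / R ^ k"
    using assms by (simp add: field_simps power_mult power2_eq_square flip: power_mult_distrib)
  finally show ?thesis .
qed

text \<open>
  Moments of order \<open>2 * k\<close> bounded uniformly allow truncating \<open>x ^ k\<close> at \<open>R\<close> with an error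
  \<open>O(R ^ (- k))\<close> in all the measures at once, and the truncated powers are bounded and
  continuous.
\<close>

lemma weak_limit_moment:
  fixes \<mu> :: "nat \<Rightarrow> real measure"
  assumes \<mu>: "\<And>n. real_distribution (\<mu> n)" and M: "real_distribution M"
    and w: "weak_conv_m \<mu> M"
    and int: "\<And>n. integrable (\<mu> n) (\<lambda>x. x ^ (2 * k))"
    and B: "\<And>n. (LINT x|\<mu> n. x ^ (2 * k)) \<le> B"
    and lim: "(\<lambda>n. LINT x|\<mu> n. x ^ k) \<longlonglongrightarrow> m"
  shows "integrable M (\<lambda>x. x ^ k)" "(LINT x|M. x ^ k) = m"
proof -
  interpret \<mu>: real_distribution "\<mu> n" for n by (rule \<mu>)
  interpret M: real_distribution M by (rule M)
  note even = weak_limit_even_moment[OF \<mu> M w int B]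
  show intk: "integrable M (\<lambda>x. x ^ k)"
    using even(1) by (rule M.integrable_power_if_even)
  have B0: "0 \<le> B"
    using order_trans[OF Bochner_Integration.integral_nonneg B[of 0]] by simp
  have close: "\<bar>(LINT x|N. x ^ k) - (LINT x|N. (max (- R) (min R x)) ^ k)\<bar> \<le> 2 * B / R ^ k"
    if N: "real_distribution N" and i: "integrable N (\<lambda>x. x ^ (2 * k))"
      and b: "(LINT x|N. x ^ (2 * k)) \<le> B" and R: "R > 0" for N and R :: real
  proof -
    interpret N: real_distribution N by (rule N)
    have i1: "integrable N (\<lambda>x. x ^ k)" using i by (rule N.integrable_power_if_even)
    have i2: "integrable N (\<lambda>x. (max (- R) (min R x)) ^ k)"
      using R by (intro N.integrable_const_bound[where B = "R ^ k"])
        (auto simp: power_abs intro!: power_mono)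
    have "\<bar>(LINT x|N. x ^ k) - (LINT x|N. (max (- R) (min R x)) ^ k)\<bar>
        = \<bar>LINT x|N. x ^ k - (max (- R) (min R x)) ^ k\<bar>"
      using i1 i2 by (subst Bochner_Integration.integral_diff) auto
    also have "\<dots> \<le> (LINT x|N. \<bar>x ^ k - (max (- R) (min R x)) ^ k\<bar>)"
      by (rule integral_abs_bound)
    also have "\<dots> \<le> (LINT x|N. 2 * x ^ (2 * k) / R ^ k)"
      using i1 i2 i clamp_power_error[OF R] by (intro integral_mono) auto
    also have "\<dots> = 2 * (LINT x|N. x ^ (2 * k)) / R ^ k"
      by simp
    also have "\<dots> \<le> 2 * B / R ^ k"
      using b R by (intro divide_right_mono) auto
    finally show ?thesis .
  qed
  have clim: "(\<lambda>n. LINT x|\<mu> n. (max (- R) (min R x)) ^ k) \<longlonglongrightarrow> (LINT x|M. (max (- R) (min R x)) ^ k)"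
    if R: "R > 0" for R :: real
    using R by (intro weak_conv_imp_integral_bdd_continuous_conv[OF \<mu> M w, where B = "R ^ k"] continuous_intros)
      (auto simp: power_abs intro!: power_mono)
  have bound: "\<bar>(LINT x|M. x ^ k) - m\<bar> \<le> 4 * B / R ^ k" if R: "R > 0" for R :: real
  proof -
    have "(\<lambda>n. \<bar>(LINT x|M. (max (- R) (min R x)) ^ k) - (LINT x|M. x ^ k)
        - ((LINT x|\<mu> n. (max (- R) (min R x)) ^ k) - (LINT x|\<mu> n. x ^ k))\<bar>)
      \<longlonglongrightarrow> \<bar>(LINT x|M. (max (- R) (min R x)) ^ k) - (LINT x|M. x ^ k)
        - ((LINT x|M. (max (- R) (min R x)) ^ k) - m)\<bar>"
      by (intro tendsto_intros clim lim R)
    then have "\<bar>(LINT x|M. (max (- R) (min R x)) ^ k) - (LINT x|M. x ^ k)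
        - ((LINT x|M. (max (- R) (min R x)) ^ k) - m)\<bar> \<le> 4 * B / R ^ k"
    proof (rule LIMSEQ_le_const2, intro exI allI impI)
      fix n :: nat
      show "\<bar>(LINT x|M. (max (- R) (min R x)) ^ k) - (LINT x|M. x ^ k)
        - ((LINT x|\<mu> n. (max (- R) (min R x)) ^ k) - (LINT x|\<mu> n. x ^ k))\<bar> \<le> 4 * B / R ^ k"
        using close[OF M even R] close[OF \<mu> int B R, of n] by linarith
    qed
    then show ?thesis by linarith
  qed
  show "(LINT x|M. x ^ k) = m"
  proof (cases "k = 0")
    case True
    then have "(\<lambda>n. 1) \<longlonglongrightarrow> m" using lim \<mu>.prob_space by simp
    then have "m = 1" by (simp add: LIMSEQ_const_iff)
    then show ?thesis using True M.prob_space by simp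
  next
    case False
    have "(\<lambda>n. 4 * B / real (Suc n) ^ k) \<longlonglongrightarrow> 0"
      using False
      by (intro real_tendsto_divide_at_top[OF tendsto_const] filterlim_pow_at_top
          filterlim_compose[OF filterlim_real_sequentially filterlim_Suc]) auto
    then have "\<bar>(LINT x|M. x ^ k) - m\<bar> \<le> 0"
      by (rule LIMSEQ_le_const) (use bound in auto)
    then show ?thesis by simp
  qed
qed

text \<open>
  The Taylor remainder of order \<open>2 * k\<close> of a characteristic function is bounded by the moment of
  order \<open>2 * k\<close>. If these remainders vanish at every \<open>t\<close>, the moments fix the characteristic
  function.
\<close>

lemma moments_determine:
  assumes M: "real_distribution M" and N: "real_distribution N"
    and M1: "\<And>k. integrable M (\<lambda>x. x ^ k)" "\<And>k. (LINT x|M. x ^ k) = m k"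
    and N1: "\<And>k. integrable N (\<lambda>x. x ^ k)" "\<And>k. (LINT x|N. x ^ k) = m k"
    and dec: "\<And>t. (\<lambda>k. t ^ (2 * k) * m (2 * k) / fact (2 * k)) \<longlonglongrightarrow> 0"
  shows "M = N"
proof -
  interpret M: real_distribution M by (rule M)
  interpret N: real_distribution N by (rule N)
  have "char M t = char N t" for t
  proof -
    let ?s = "\<lambda>n. (\<Sum>k\<le>n. ((\<i> * t)^k / fact k) * complex_of_real (m k))"
    have b: "cmod (char M t - char N t) \<le> 4 * (t ^ (2 * k) * m (2 * k) / fact (2 * k))" for k
    proof -
      have "cmod (char M t - ?s (2 * k)) \<le> (2*\<bar>t\<bar>^(2 * k) / fact (2 * k)) * m (2 * k)"
        using M.char_approx1[of "2 * k" t] M1 by (simp add: power_even_abs)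
      moreover have "cmod (char N t - ?s (2 * k)) \<le> (2*\<bar>t\<bar>^(2 * k) / fact (2 * k)) * m (2 * k)"
        using N.char_approx1[of "2 * k" t] N1 by (simp add: power_even_abs)
      moreover have "cmod (char M t - char N t) \<le> cmod (char M t - ?s (2 * k)) + cmod (char N t - ?s (2 * k))"
        using dist_triangle2[of "char M t" "char N t" "?s (2 * k)"] by (simp only: dist_norm)
      ultimately show ?thesis by (simp add: power_even_abs)
    qed
    have "(\<lambda>k. 4 * (t ^ (2 * k) * m (2 * k) / fact (2 * k))) \<longlonglongrightarrow> 4 * 0"
      by (intro tendsto_intros dec)
    then have "cmod (char M t - char N t) \<le> 4 * 0"
      by (rule LIMSEQ_le_const) (use b in auto)
    then show ?thesis by simp
  qed
  then show ?thesis using Levy_uniqueness[OF M N] by blast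
qed

lemma second_moments_bounded_imp_tight:
  fixes \<mu> :: "nat \<Rightarrow> real measure"
  assumes \<mu>: "\<And>n. real_distribution (\<mu> n)"
    and int: "\<And>n. integrable (\<mu> n) (\<lambda>x. x ^ 2)"
    and B: "\<And>n. (LINT x|\<mu> n. x ^ 2) \<le> B"
  shows "tight \<mu>"
  unfolding tight_def
proof (intro conjI allI impI \<mu>)
  fix \<epsilon> :: real assume e: "0 < \<epsilon>"
  have B0: "0 \<le> B"
    using order_trans[OF Bochner_Integration.integral_nonneg B[of 0]] by simp
  \<comment> \<open>Chebyshev: \<open>B / R\<^sup>2 \<le> B / R < \<epsilon>\<close> as \<open>R \<ge> 1\<close> and \<open>R * \<epsilon> > B\<close>.\<close>
  define R where "R = (B + 1) / \<epsilon> + 1"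
  have R: "R \<ge> 1" "R * \<epsilon> > B" "R > 0"
    using e B0 by (auto simp: R_def field_simps add_strict_increasing)
  have "measure (\<mu> n) {- R<..R} > 1 - \<epsilon>" for n
  proof -
    interpret real_distribution "\<mu> n" by (rule \<mu>)
    have "prob {x \<in> space (\<mu> n). x ^ 2 \<ge> R\<^sup>2} \<le> (LINT x|\<mu> n. x ^ 2) / R\<^sup>2"
      using R int by (intro integral_Markov_inequality_measure[where A = "{}"]) auto
    also have "\<dots> \<le> B / R\<^sup>2" using B R by (intro divide_right_mono) auto
    also have "\<dots> \<le> B / R"
      using B0 R by (intro divide_left_mono) (auto simp: power2_eq_square)
    also have "\<dots> < \<epsilon>" using R by (simp add: field_simps)
    finally have 1: "prob {x. x ^ 2 \<ge> R\<^sup>2} < \<epsilon>" by simp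
    have "1 - prob {- R<..R} = prob (UNIV - {- R<..R})"
      using prob_compl[of "{- R<..R}"] by simp
    also have "\<dots> \<le> prob {x. x ^ 2 \<ge> R\<^sup>2}"
    proof (rule finite_measure_mono)
      show "UNIV - {- R<..R} \<subseteq> {x. x ^ 2 \<ge> R\<^sup>2}"
      proof
        fix x assume "x \<in> UNIV - {- R<..R}"
        then have "\<bar>R\<bar> \<le> \<bar>x\<bar>" using R by auto
        then show "x \<in> {x. x ^ 2 \<ge> R\<^sup>2}" by (simp add: abs_le_square_iff)
      qed
    qed auto
    finally show ?thesis using 1 by linarith
  qed
  then show "\<exists>a b. a < b \<and> (\<forall>n. 1 - \<epsilon> < measure (\<mu> n) {a<..b})"
    using R by (intro exI[of _ "- R"] exI[of _ R]) auto
qed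

text \<open>
  Bounded second moments give tightness. Each weak limit along a subsequence inherits the
  moments \<open>m\<close>, so all these limits coincide.
\<close>

theorem method_of_moments:
  fixes \<mu> :: "nat \<Rightarrow> real measure"
  assumes \<mu>: "\<And>n. real_distribution (\<mu> n)"
    and int: "\<And>n k. integrable (\<mu> n) (\<lambda>x. x ^ k)"
    and lim: "\<And>k. (\<lambda>n. LINT x|\<mu> n. x ^ k) \<longlonglongrightarrow> m k"
    and dec: "\<And>t. (\<lambda>k. t ^ (2 * k) * m (2 * k) / fact (2 * k)) \<longlonglongrightarrow> 0"
  obtains M where "real_distribution M" "weak_conv_m \<mu> M"
    "\<And>k. integrable M (\<lambda>x. x ^ k)" "\<And>k. (LINT x|M. x ^ k) = m k"
proof -
  have "\<exists>B. \<forall>n. (LINT x|\<mu> n. x ^ k) \<le> B" for k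
  proof -
    have "Bseq (\<lambda>n. LINT x|\<mu> n. x ^ k)"
      using lim by (intro convergent_imp_Bseq convergentI)
    then show ?thesis
      by (auto simp: Bseq_def) (meson abs_le_D1)
  qed
  then obtain B where B: "\<And>n k. (LINT x|\<mu> n. x ^ k) \<le> B k" by metis
  have tight: "tight \<mu>"
    using \<mu> int B by (rule second_moments_bounded_imp_tight)
  have sub: "(\<forall>k. integrable \<nu> (\<lambda>x. x ^ k)) \<and> (\<forall>k. (LINT x|\<nu>. x ^ k) = m k)"
    if s: "strict_mono s" and \<nu>: "real_distribution \<nu>" and w: "weak_conv_m (\<mu> \<circ> s) \<nu>" for s \<nu>
  proof (intro conjI allI)
    fix k
    have l: "(\<lambda>n. LINT x|(\<mu> \<circ> s) n. x ^ k) \<longlonglongrightarrow> m k"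
      using LIMSEQ_subseq_LIMSEQ[OF lim[of k] s] by (simp add: o_def)
    show "integrable \<nu> (\<lambda>x. x ^ k)" "(LINT x|\<nu>. x ^ k) = m k"
      by (rule weak_limit_moment[OF _ \<nu> w _ _ l, where B = "B (2 * k)"]; simp add: \<mu> int B)+
  qed
  obtain r M where r: "strict_mono r" "real_distribution M" "weak_conv_m (\<mu> \<circ> id \<circ> r) M"
    using tight_imp_convergent_subsubsequence[OF tight, of id] by (auto simp: strict_mono_def)
  then have M: "\<And>k. integrable M (\<lambda>x. x ^ k)" "\<And>k. (LINT x|M. x ^ k) = m k"
    using sub[of r M] by auto
  have "weak_conv_m \<mu> M"
  proof (rule tight_subseq_weak_converge[OF \<mu> r(2) tight])
    fix s \<nu> assume s: "strict_mono s" "real_distribution \<nu>" "weak_conv_m (\<mu> \<circ> s) \<nu>"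
    then have "\<nu> = M"
      using sub[OF s] M by (intro moments_determine[OF s(2) r(2) _ _ _ _ dec]) auto
    then show "weak_conv_m (\<mu> \<circ> s) M" using s by simp
  qed
  then show ?thesis using that r M by blast
qed

text \<open>
  A form of Slutsky's theorem: since \<open>exp (i t x)\<close> is Lipschitz in \<open>x\<close> with constant \<open>\<bar>t\<bar>\<close>, a
  difference that is small in mean changes the characteristic functions little.
\<close>

lemma weak_conv_perturbation:
  fixes P :: "nat \<Rightarrow> 'a pmf" and X Y :: "nat \<Rightarrow> 'a \<Rightarrow> real"
  assumes M: "real_distribution M"
    and w: "weak_conv_m (\<lambda>n. distr (measure_pmf (P n)) borel (Y n)) M"
    and int: "\<And>n. integrable (measure_pmf (P n)) (\<lambda>x. X n x - Y n x)"
    and lim: "(\<lambda>n. measure_pmf.expectation (P n) (\<lambda>x. \<bar>X n x - Y n x\<bar>)) \<longlonglongrightarrow> 0"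
  shows "weak_conv_m (\<lambda>n. distr (measure_pmf (P n)) borel (X n)) M"
proof (rule levy_continuity[OF _ M])
  have rd: "real_distribution (distr (measure_pmf (P n)) borel (Z n))" for Z :: "nat \<Rightarrow> 'a \<Rightarrow> real" and n
    by (rule prob_space.real_distribution_distr[OF measure_pmf.prob_space_axioms]) auto
  show "real_distribution (distr (measure_pmf (P n)) borel (X n))" for n by (rule rd)
  fix t :: real
  have cx: "char (distr (measure_pmf (P n)) borel (Z n)) t = measure_pmf.expectation (P n) (\<lambda>x. iexp (t * Z n x))"
    for Z :: "nat \<Rightarrow> 'a \<Rightarrow> real" and n
    unfolding char_def by (subst integral_distr) auto
  have Y: "(\<lambda>n. char (distr (measure_pmf (P n)) borel (Y n)) t) \<longlonglongrightarrow> char M t"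
    by (rule levy_continuity1[OF _ M w]) (rule rd)
  have ii: "integrable (measure_pmf (P n)) (\<lambda>x. iexp (t * Z n x))" for Z :: "nat \<Rightarrow> 'a \<Rightarrow> real" and n
    by (intro measure_pmf.integrable_const_bound[where B = 1]) auto
  have bound: "norm (char (distr (measure_pmf (P n)) borel (X n)) t - char (distr (measure_pmf (P n)) borel (Y n)) t)
      \<le> \<bar>t\<bar> * measure_pmf.expectation (P n) (\<lambda>x. \<bar>X n x - Y n x\<bar>)" for n
  proof -
    have "norm (measure_pmf.expectation (P n) (\<lambda>x. iexp (t * X n x) - iexp (t * Y n x)))
        \<le> measure_pmf.expectation (P n) (\<lambda>x. norm (iexp (t * X n x) - iexp (t * Y n x)))"
      by (rule integral_norm_bound)
    also have "\<dots> \<le> measure_pmf.expectation (P n) (\<lambda>x. \<bar>t\<bar> * \<bar>X n x - Y n x\<bar>)"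
    proof (rule integral_mono)
      show "norm (iexp (t * X n x) - iexp (t * Y n x)) \<le> \<bar>t\<bar> * \<bar>X n x - Y n x\<bar>" for x
      proof -
        have "iexp (t * X n x) - iexp (t * Y n x) = iexp (t * Y n x) * (iexp (t * (X n x - Y n x)) - 1)"
          by (simp add: algebra_simps flip: exp_add)
        then have "norm (iexp (t * X n x) - iexp (t * Y n x)) = norm (iexp (t * (X n x - Y n x)) - 1)"
          by (simp add: norm_mult)
        also have "\<dots> \<le> \<bar>t * (X n x - Y n x)\<bar>"
          using iexp_approx1[of "t * (X n x - Y n x)" 0] by simp
        finally show ?thesis by (simp add: abs_mult)
      qed
      show "integrable (measure_pmf (P n)) (\<lambda>x. norm (iexp (t * X n x) - iexp (t * Y n x)))"
        by (intro integrable_norm Bochner_Integration.integrable_diff ii)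
      show "integrable (measure_pmf (P n)) (\<lambda>x. \<bar>t\<bar> * \<bar>X n x - Y n x\<bar>)"
        using int by auto
    qed
    finally show ?thesis
      unfolding cx Bochner_Integration.integral_diff[OF ii ii] by simp
  qed
  have "(\<lambda>n. \<bar>t\<bar> * measure_pmf.expectation (P n) (\<lambda>x. \<bar>X n x - Y n x\<bar>)) \<longlonglongrightarrow> 0"
    using tendsto_mult_right_zero[OF lim] by simp
  then have "(\<lambda>n. char (distr (measure_pmf (P n)) borel (X n)) t
      - char (distr (measure_pmf (P n)) borel (Y n)) t) \<longlonglongrightarrow> 0"
    by (rule Lim_null_comparison[OF always_eventually[OF allI[OF bound]]])
  from tendsto_add[OF this Y]
  show "(\<lambda>n. char (distr (measure_pmf (P n)) borel (X n)) t) \<longlonglongrightarrow> char M t" by simp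
qed

section \<open>Moments of the number of open slots\<close>

context broadcasting
begin

text \<open>
  The shift for which \<open>total_slots d n = (d - 1) * (n + b)\<close>, so that products over \<open>n\<close> become
  Pochhammer symbols starting at \<open>b\<close>.
\<close>

definition b :: real where "b = 1 / (real d - 1)"

definition \<gamma> :: real where "\<gamma> = a / (real d - 1)"

definition limit_moment :: "nat \<Rightarrow> real" where
  "limit_moment k = D k * Gamma b / Gamma (b + real k * \<gamma>)"

lemma b_pos: "b > 0" and \<gamma>_pos: "\<gamma> > 0"
  using d a_pos by (auto simp: b_def \<gamma>_def)

lemma total_slots_eq: "total_slots d n = (real d - 1) * (real n + b)"
  using d by (simp add: total_slots_def b_def field_simps)

lemmas step = tree_mean_Suc[OF d p0 p1]

text \<open>
  By the eigenfunction property a step multiplies the mean by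
  \<open>1 + k * a / total_slots d n = (n + b + k * \<gamma>) / (n + b)\<close>. The chain starts from \<open>w = d\<close> at
  \<open>n = 1\<close>, so the factors with index 0 of the two Pochhammer symbols have to be taken out.
\<close>

lemma mean_g:
  assumes "n \<ge> 1"
  shows "tree_mean d p n (\<lambda>w c. g k w)
    = g k d * (b / (b + real k * \<gamma>)) * (pochhammer (b + real k * \<gamma>) n / pochhammer b n)"
  using assms
proof (induction n rule: nat_induct_at_least)
  case base
  have "b + real k * \<gamma> > 0" using b_pos \<gamma>_pos by (simp add: add_pos_nonneg)
  then show ?case using b_pos by (simp add: tree_mean_1[unfolded One_nat_def])
next
  case (Suc n)
  have "tree_mean d p (Suc n) (\<lambda>w c. g k w)
      = tree_mean d p n (\<lambda>w c. (1 + real k * a / total_slots d n) * g k w)"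
  proof -
    have "g k w + real w / total_slots d n * (p * g k (w + d - 1) + (1 - p) * g k (w - 1) - g k w)
        = (1 + real k * a / total_slots d n) * g k w" for w
      by (simp only: times_divide_eq_left g_eigen[symmetric]) (simp add: algebra_simps)
    then show ?thesis by (simp only: step[OF Suc.hyps])
  qed
  also have "\<dots> = (1 + real k * a / total_slots d n) * tree_mean d p n (\<lambda>w c. g k w)"
    by (rule tree_mean_cmult)
  also have "1 + real k * a / total_slots d n = (b + real k * \<gamma> + real n) / (b + real n)"
  proof -
    have "b + real n > 0" using b_pos by (simp add: add_pos_nonneg)
    moreover have "real k * a / total_slots d n = real k * \<gamma> / (b + real n)"
      using d by (simp add: total_slots_eq \<gamma>_def add.commute)
    ultimately show ?thesis by (simp add: field_simps)
  qed
  finally show ?case using Suc.IH by (simp add: pochhammer_Suc mult_ac)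
qed

lemma mean_g_asymptotics:
  "(\<lambda>n. tree_mean d p n (\<lambda>w c. g k w) / real n powr (real k * \<gamma>)) \<longlonglongrightarrow> limit_moment k / fact k"
proof -
  have pos: "b + real k * \<gamma> > 0" using b_pos \<gamma>_pos by (simp add: add_pos_nonneg)
  have "(\<lambda>n. g k d * (b / (b + real k * \<gamma>)) *
      (pochhammer (b + real k * \<gamma>) n / pochhammer b n / real n powr (real k * \<gamma>)))
    \<longlonglongrightarrow> g k d * (b / (b + real k * \<gamma>)) * (Gamma b / Gamma (b + real k * \<gamma>))"
    using b_pos \<gamma>_pos by (intro tendsto_mult_left pochhammer_ratio_asymptotics) auto
  moreover have "g k d * (b / (b + real k * \<gamma>)) * (Gamma b / Gamma (b + real k * \<gamma>)) = limit_moment k / fact k"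
  proof -
    have "b + real k * \<gamma> = (1 + real k * a) * b" by (simp add: \<gamma>_def b_def algebra_simps)
    then have "g k d * (b / (b + real k * \<gamma>)) = D k / fact k"
      using pos b_pos by (auto simp: g_d zero_less_mult_iff)
    then show ?thesis by (simp add: limit_moment_def)
  qed
  moreover have "\<forall>\<^sub>F n in sequentially. g k d * (b / (b + real k * \<gamma>)) *
      (pochhammer (b + real k * \<gamma>) n / pochhammer b n / real n powr (real k * \<gamma>))
    = tree_mean d p n (\<lambda>w c. g k w) / real n powr (real k * \<gamma>)"
    using eventually_ge_at_top[of 1] by eventually_elim (simp add: mean_g)
  ultimately show ?thesis by (simp add: Lim_transform_eventually)
qed

text \<open>
  Express \<open>w ^ k\<close> through \<open>g k w\<close> and lower powers of \<open>w\<close>; by induction the latter have means of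
  smaller order than \<open>n powr (k * \<gamma>)\<close>.
\<close>

lemma slots_moment_asymptotics:
  "(\<lambda>n. tree_mean d p n (\<lambda>w c. real w ^ k) / real n powr (real k * \<gamma>)) \<longlonglongrightarrow> (a / p) ^ k * limit_moment k"
proof (induction k rule: less_induct)
  case (less k)
  define M where "M j n = tree_mean d p n (\<lambda>w c. real w ^ j)" for j n
  obtain q where q: "degree q \<le> k" "coeff q k = (p / a) ^ k / fact k" "\<And>w. g k w = poly q (real w)"
    using g_polynomial[of k] by blast
  have lower: "(\<lambda>n. M j n / real n powr (real k * \<gamma>)) \<longlonglongrightarrow> 0" if j: "j < k" for j
  proof -
    have "(\<lambda>n. real n powr (- (real (k - j) * \<gamma>))) \<longlonglongrightarrow> 0"
      using j \<gamma>_pos by (intro tendsto_neg_powr filterlim_real_sequentially) simp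
    then have "(\<lambda>n. M j n / real n powr (real j * \<gamma>) * real n powr (- (real (k - j) * \<gamma>)))
        \<longlonglongrightarrow> (a / p) ^ j * limit_moment j * 0"
      using less.IH[OF j] unfolding M_def by (intro tendsto_mult)
    moreover have "M j n / real n powr (real j * \<gamma>) * real n powr (- (real (k - j) * \<gamma>))
        = M j n / real n powr (real k * \<gamma>)" for n
    proof -
      have "real k * \<gamma> = real j * \<gamma> + real (k - j) * \<gamma>" using j by (simp add: of_nat_diff algebra_simps)
      then show ?thesis by (simp add: powr_add powr_minus field_simps)
    qed
    ultimately show ?thesis by simp
  qed
  have eq: "tree_mean d p n (\<lambda>w c. g k w) = (p / a) ^ k / fact k * M k n + (\<Sum>j<k. coeff q j * M j n)" for n
  proof -
    have "poly q x = (\<Sum>j\<le>k. coeff q j * x ^ j)" for x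
      unfolding poly_altdef
      by (rule sum.mono_neutral_left) (use q(1) in \<open>auto simp: coeff_eq_0\<close>)
    then have "tree_mean d p n (\<lambda>w c. g k w) = (\<Sum>j\<le>k. coeff q j * M j n)"
      by (simp add: q(3) tree_mean_sum[OF d] tree_mean_cmult M_def)
    then show ?thesis
      by (simp add: lessThan_Suc_atMost[symmetric] q(2))
  qed
  have "(\<lambda>n. tree_mean d p n (\<lambda>w c. g k w) / real n powr (real k * \<gamma>)
        - (\<Sum>j<k. coeff q j * (M j n / real n powr (real k * \<gamma>))))
      \<longlonglongrightarrow> limit_moment k / fact k - (\<Sum>j<k. coeff q j * 0)"
    by (intro tendsto_diff mean_g_asymptotics tendsto_sum tendsto_mult_left lower) simp
  moreover have "tree_mean d p n (\<lambda>w c. g k w) / real n powr (real k * \<gamma>)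
        - (\<Sum>j<k. coeff q j * (M j n / real n powr (real k * \<gamma>)))
      = (p / a) ^ k / fact k * (M k n / real n powr (real k * \<gamma>))" for n
    by (simp add: eq add_divide_distrib sum_divide_distrib)
  ultimately have "(\<lambda>n. (p / a) ^ k / fact k * (M k n / real n powr (real k * \<gamma>)))
      \<longlonglongrightarrow> limit_moment k / fact k" by simp
  from tendsto_mult_left[OF this, of "(a / p) ^ k * fact k"]
  show ?case using a_pos p_pos by (simp add: M_def power_divide)
qed

section \<open>From open slots to the size of the cluster\<close>

text \<open>
  When the cluster is hit, \<open>a * c - p * w\<close> changes by \<open>- (1 - p)\<close> with probability \<open>p\<close> and by \<open>p\<close>
  with probability \<open>1 - p\<close>, a centred step of variance \<open>p * (1 - p)\<close>. The hitting probability
  \<open>w / total_slots d n\<close> is \<open>1 / a\<close> times the mean growth of \<open>w\<close>, so the variances telescope.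
\<close>

lemma cluster_slots_difference:
  assumes "n \<ge> 1"
  shows "tree_mean d p n (\<lambda>w c. (a * real c - p * real w)\<^sup>2)
    = 1 + p * (1 - p) / a * (tree_mean d p n (\<lambda>w c. real w) - real d)"
  using assms
proof (induction n rule: nat_induct_at_least)
  case base
  have "a - p * real d = - 1" by (simp add: a_def)
  then show ?case by (simp add: tree_mean_1[unfolded One_nat_def])
next
  case (Suc n)
  let ?\<tau> = "total_slots d n"
  have 1: "tree_mean d p (Suc n) (\<lambda>w c. real w) = tree_mean d p n (\<lambda>w c. (1 + a / ?\<tau>) * real w)"
  proof -
    have "real w + real w / ?\<tau> * (p * real (w + d - 1) + (1 - p) * real (w - 1) - real w)
        = (1 + a / ?\<tau>) * real w" for w
    proof (cases w)
      case (Suc v)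
      have "p * real (w + d - 1) + (1 - p) * real (w - 1) - real w = a"
        using d Suc by (simp add: a_def algebra_simps of_nat_diff)
      then show ?thesis by (simp add: algebra_simps)
    qed simp
    then show ?thesis by (simp only: step[OF Suc.hyps])
  qed
  have 2: "tree_mean d p (Suc n) (\<lambda>w c. (a * real c - p * real w)\<^sup>2)
      = tree_mean d p n (\<lambda>w c. (a * real c - p * real w)\<^sup>2 + p * (1 - p) / ?\<tau> * real w)"
  proof -
    have "(a * real c - p * real w)\<^sup>2 + real w / ?\<tau> *
        (p * (a * real (c + 1) - p * real (w + d - 1))\<^sup>2
          + (1 - p) * (a * real c - p * real (w - 1))\<^sup>2 - (a * real c - p * real w)\<^sup>2)
      = (a * real c - p * real w)\<^sup>2 + p * (1 - p) / ?\<tau> * real w" for w c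
    proof (cases w)
      case (Suc v)
      define x where "x = a * real c - p * real w"
      have "a * real (c + 1) - p * real (w + d - 1) = x - (1 - p)" "a * real c - p * real (w - 1) = x + p"
        using d Suc by (simp_all add: x_def a_def algebra_simps of_nat_diff)
      moreover have "p * (x - (1 - p))\<^sup>2 + (1 - p) * (x + p)\<^sup>2 - x\<^sup>2 = p * (1 - p)"
        by (simp add: power2_eq_square algebra_simps)
      ultimately show ?thesis unfolding x_def[symmetric] by simp
    qed simp
    then show ?thesis by (simp only: step[OF Suc.hyps])
  qed
  show ?case
    unfolding 1 2 tree_mean_add[OF d] tree_mean_cmult Suc.IH using a_pos by (simp add: field_simps)
qed

text \<open>
  The condition under which the limit moments determine their distribution: they are at most a
  constant times \<open>k! * B ^ k / Gamma (b + k * \<gamma>)\<close>.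
\<close>

lemma limit_moment_decay:
  "(\<lambda>k. t ^ (2 * k) * limit_moment (2 * k) / fact (2 * k)) \<longlonglongrightarrow> 0"
proof -
  obtain B where B: "B > 0" "\<And>k. D k / fact k \<le> B ^ k" using D_growth by blast
  let ?u = "\<lambda>k. (\<bar>t\<bar> * B) ^ k / Gamma (b + real k * \<gamma>)"
  have "?u \<longlonglongrightarrow> 0"
    using B b_pos \<gamma>_pos by (intro power_over_Gamma_tendsto_0) auto
  then have "(\<lambda>k. ?u (2 * k)) \<longlonglongrightarrow> 0"
    using LIMSEQ_subseq_LIMSEQ[of ?u 0 "\<lambda>k. 2 * k"] by (simp add: strict_mono_def o_def)
  then have lim: "(\<lambda>k. Gamma b * ?u (2 * k)) \<longlonglongrightarrow> 0"
    by (rule tendsto_mult_right_zero)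
  have G: "Gamma b > 0" "Gamma (b + real k * \<gamma>) > 0" for k
    using b_pos \<gamma>_pos by (auto intro!: Gamma_real_pos add_pos_nonneg)
  have bound: "norm (t ^ (2 * k) * limit_moment (2 * k) / fact (2 * k)) \<le> Gamma b * ?u (2 * k)" for k
  proof -
    have "\<bar>t\<bar> ^ (2 * k) * (D (2 * k) / fact (2 * k)) * (Gamma b / Gamma (b + real (2 * k) * \<gamma>))
        \<le> \<bar>t\<bar> ^ (2 * k) * B ^ (2 * k) * (Gamma b / Gamma (b + real (2 * k) * \<gamma>))"
    proof (intro mult_right_mono mult_left_mono B(2))
      show "0 \<le> Gamma b / Gamma (b + real (2 * k) * \<gamma>)"
        using G(1) G(2)[of "2 * k"] by (intro divide_nonneg_nonneg less_imp_le)
    qed simp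
    moreover have "norm (t ^ (2 * k) * limit_moment (2 * k) / fact (2 * k))
        = \<bar>t\<bar> ^ (2 * k) * (D (2 * k) / fact (2 * k)) * (Gamma b / Gamma (b + real (2 * k) * \<gamma>))"
      using D_nonneg[of "2 * k"] G[THEN less_imp_le] G(2)[of "2 * k"] unfolding limit_moment_def
      by (simp add: abs_mult power_abs mult_ac)
    ultimately show ?thesis by (simp add: power_mult_distrib mult_ac)
  qed
  show ?thesis by (rule Lim_null_comparison[OF always_eventually[OF allI[OF bound]] lim])
qed

definition scaled_slots :: "nat \<Rightarrow> coloured_tree \<Rightarrow> real" where
  "scaled_slots n t = p / a * real (open_slots d t) / real n powr \<gamma>"

definition scaled_size :: "nat \<Rightarrow> coloured_tree \<Rightarrow> real" where
  "scaled_size n t = real (cluster_size t) / real n powr \<gamma>"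

lemma integrable_tree: "integrable (measure_pmf (tree_pmf d p n)) (f :: coloured_tree \<Rightarrow> real)"
  by (intro integrable_measure_pmf_finite finite_set_tree_pmf d)

lemma scaled_slots_moments:
  "(\<lambda>n. measure_pmf.expectation (tree_pmf d p n) (\<lambda>t. scaled_slots n t ^ k)) \<longlonglongrightarrow> limit_moment k"
proof -
  have "(\<lambda>n. (p / a) ^ k * (tree_mean d p n (\<lambda>w c. real w ^ k) / real n powr (real k * \<gamma>)))
      \<longlonglongrightarrow> (p / a) ^ k * ((a / p) ^ k * limit_moment k)"
    by (intro tendsto_mult_left slots_moment_asymptotics)
  moreover have "(p / a) ^ k * ((a / p) ^ k * limit_moment k) = limit_moment k"
    using a_pos p_pos by (simp add: power_divide)
  moreover have "\<forall>\<^sub>F n in sequentially. (p / a) ^ k * (tree_mean d p n (\<lambda>w c. real w ^ k) / real n powr (real k * \<gamma>))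
      = measure_pmf.expectation (tree_pmf d p n) (\<lambda>t. scaled_slots n t ^ k)"
    using eventually_gt_at_top[of 0]
  proof eventually_elim
    case (elim n)
    have "(real n powr \<gamma>) ^ k = real n powr (real k * \<gamma>)"
      using elim by (simp add: powr_power)
    then have "scaled_slots n t ^ k = (p / a) ^ k / real n powr (real k * \<gamma>) * real (open_slots d t) ^ k" for t
      by (simp add: scaled_slots_def power_divide power_mult_distrib)
    then show ?case by (simp add: tree_mean_def)
  qed
  ultimately show ?thesis by (simp add: Lim_transform_eventually)
qed

text \<open>
  The difference is \<open>a * c - p * w\<close> divided by \<open>a * n powr \<gamma>\<close>. Its second moment is at most of order
  \<open>n powr (- \<gamma>)\<close>, and the first absolute moment is bounded by the root of the second.
\<close>

lemma scaled_difference: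
  "(\<lambda>n. measure_pmf.expectation (tree_pmf d p n) (\<lambda>t. \<bar>scaled_size n t - scaled_slots n t\<bar>)) \<longlonglongrightarrow> 0"
proof -
  define V where "V n = measure_pmf.expectation (tree_pmf d p n) (\<lambda>t. (scaled_size n t - scaled_slots n t)\<^sup>2)" for n
  have neg: "(\<lambda>n. real n powr (- \<gamma>)) \<longlonglongrightarrow> 0"
    using \<gamma>_pos by (intro tendsto_neg_powr filterlim_real_sequentially) simp
  have lin: "(\<lambda>n. tree_mean d p n (\<lambda>w c. real w) / real n powr \<gamma>) \<longlonglongrightarrow> a / p * limit_moment 1"
    using slots_moment_asymptotics[of 1] by simp
  have "(\<lambda>n. 1 / a\<^sup>2 * ((1 - p * (1 - p) / a * real d) * (real n powr (- \<gamma>) * real n powr (- \<gamma>))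
      + p * (1 - p) / a * (tree_mean d p n (\<lambda>w c. real w) / real n powr \<gamma> * real n powr (- \<gamma>))))
    \<longlonglongrightarrow> 1 / a\<^sup>2 * ((1 - p * (1 - p) / a * real d) * (0 * 0) + p * (1 - p) / a * (a / p * limit_moment 1 * 0))"
    by (intro tendsto_intros neg lin)
  moreover have "\<forall>\<^sub>F n in sequentially. 1 / a\<^sup>2 * ((1 - p * (1 - p) / a * real d) * (real n powr (- \<gamma>) * real n powr (- \<gamma>))
      + p * (1 - p) / a * (tree_mean d p n (\<lambda>w c. real w) / real n powr \<gamma> * real n powr (- \<gamma>))) = V n"
    using eventually_ge_at_top[of 1]
  proof eventually_elim
    case (elim n)
    define N where "N = real n powr \<gamma>"
    have N: "N > 0" using elim by (simp add: N_def)
    have "(scaled_size n t - scaled_slots n t)\<^sup>2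
        = 1 / (a * N)\<^sup>2 * (a * real (cluster_size t) - p * real (open_slots d t))\<^sup>2" for t
    proof -
      have "scaled_size n t - scaled_slots n t = 1 / (a * N) * (a * real (cluster_size t) - p * real (open_slots d t))"
        using a_pos N by (simp add: scaled_size_def scaled_slots_def N_def[symmetric] field_simps)
      then show ?thesis by (simp add: power_divide power_mult_distrib)
    qed
    then have "V n = 1 / (a * N)\<^sup>2 * tree_mean d p n (\<lambda>w c. (a * real c - p * real w)\<^sup>2)"
      unfolding V_def tree_mean_def by simp
    also have "\<dots> = 1 / (a * N)\<^sup>2 * (1 + p * (1 - p) / a * (tree_mean d p n (\<lambda>w c. real w) - real d))"
      by (simp only: cluster_slots_difference[OF elim])
    finally have V: "V n = 1 / (a * N)\<^sup>2 * (1 + p * (1 - p) / a * (tree_mean d p n (\<lambda>w c. real w) - real d))" .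
    define r where "r = p * (1 - p) / a"
    show ?case
      unfolding V powr_minus N_def[symmetric] r_def[symmetric] using N a_pos
      by (simp add: field_simps power2_eq_square)
  qed
  ultimately have "V \<longlonglongrightarrow> 0" by (simp add: Lim_transform_eventually)
  then have lim: "(\<lambda>n. sqrt (V n)) \<longlonglongrightarrow> 0"
    using tendsto_real_sqrt[of V 0] by simp
  have bound: "norm (measure_pmf.expectation (tree_pmf d p n) (\<lambda>t. \<bar>scaled_size n t - scaled_slots n t\<bar>)) \<le> sqrt (V n)" for n
  proof -
    let ?X = "\<lambda>t. \<bar>scaled_size n t - scaled_slots n t\<bar>"
    have "0 \<le> measure_pmf.variance (tree_pmf d p n) ?X" by (rule measure_pmf.variance_positive)
    also have "\<dots> = V n - (measure_pmf.expectation (tree_pmf d p n) ?X)\<^sup>2"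
      unfolding V_def by (subst measure_pmf.variance_eq) (auto intro: integrable_tree)
    finally show ?thesis by (simp add: real_le_rsqrt)
  qed
  show ?thesis
    by (rule Lim_null_comparison[OF always_eventually[OF allI[OF bound]] lim])
qed

lemma cluster_limit:
  obtains C where "real_distribution C"
    "weak_conv_m (\<lambda>n. distr (measure_pmf (tree_pmf d p n)) borel (scaled_size n)) C"
    "\<And>k. integrable C (\<lambda>x. x ^ k)" "\<And>k. (LINT x|C. x ^ k) = limit_moment k"
proof -
  let ?\<mu> = "\<lambda>n. distr (measure_pmf (tree_pmf d p n)) borel (scaled_slots n)"
  have rd: "real_distribution (?\<mu> n)" for n
    by (rule prob_space.real_distribution_distr[OF measure_pmf.prob_space_axioms]) simp
  have int: "integrable (?\<mu> n) (\<lambda>x. x ^ k)" for n k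
    by (subst integrable_distr_eq) (auto intro: integrable_tree)
  have mom: "(\<lambda>n. LINT x|?\<mu> n. x ^ k) \<longlonglongrightarrow> limit_moment k" for k
    using scaled_slots_moments[of k] by (simp add: integral_distr)
  obtain C where C: "real_distribution C" "weak_conv_m ?\<mu> C"
    "\<And>k. integrable C (\<lambda>x. x ^ k)" "\<And>k. (LINT x|C. x ^ k) = limit_moment k"
    using method_of_moments[of ?\<mu> limit_moment, OF rd int mom limit_moment_decay] by blast
  have "weak_conv_m (\<lambda>n. distr (measure_pmf (tree_pmf d p n)) borel (scaled_size n)) C"
    by (rule weak_conv_perturbation[OF C(1,2) integrable_tree scaled_difference])
  then show ?thesis using that C by blast
qed

end

theorem theorem2p15:
  fixes d :: nat and p :: real
  assumes "d \<ge> 2" and "0 \<le> p" and "p \<le> 1" and "p > 1 / real d"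
  shows "\<exists>(D :: nat \<Rightarrow> real) (C :: real measure).
    D 1 = 1 / (p * real d - 1) \<and>
    (\<forall>k\<ge>2. (real k - 1) * (p * real d - 1) * D k =
       (\<Sum>j=2..min k d. p ^ j * fact d / fact (d - j) * bell_poly k j D)) \<and>
    real_distribution C \<and>
    weak_conv_m
      (\<lambda>n. distr (measure_pmf (tree_pmf d p n)) borel
        (\<lambda>t. real (card (root_cluster t)) / real n powr ((p * real d - 1) / (real d - 1))))
      C \<and>
    (\<forall>k\<ge>1. integrable C (\<lambda>x. x ^ k) \<and>
       (LINT x|C. x ^ k) =
         D k * Gamma (1 / (real d - 1)) /
         Gamma ((real k * p * real d - real k + 1) / (real d - 1)))"
proof -
  interpret broadcasting d p using assms by unfold_locales
  obtain C where C: "real_distribution C"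
    "weak_conv_m (\<lambda>n. distr (measure_pmf (tree_pmf d p n)) borel (scaled_size n)) C"
    "\<And>k. integrable C (\<lambda>x. x ^ k)" "\<And>k. (LINT x|C. x ^ k) = limit_moment k"
    using cluster_limit by blast
  have arg: "(real k * p * real d - real k + 1) / (real d - 1) = b + real k * \<gamma>" for k
    by (simp add: b_def \<gamma>_def a_def algebra_simps flip: add_divide_distrib)
  show ?thesis
  proof (intro exI[of _ D] exI[of _ C] conjI allI impI)
    show "D 1 = 1 / (p * real d - 1)" using D_1 by (simp only: a_def)
    show "(real k - 1) * (p * real d - 1) * D k
        = (\<Sum>j=2..min k d. p ^ j * fact d / fact (d - j) * bell_poly k j D)" if "k \<ge> 2" for k
      using D_rec[OF that] by (simp only: a_def)
    show "weak_conv_m (\<lambda>n. distr (measure_pmf (tree_pmf d p n)) borel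
        (\<lambda>t. real (card (root_cluster t)) / real n powr ((p * real d - 1) / (real d - 1)))) C"
      using C(2) unfolding scaled_size_def cluster_size_def \<gamma>_def a_def .
    show "(LINT x|C. x ^ k) = D k * Gamma (1 / (real d - 1)) /
        Gamma ((real k * p * real d - real k + 1) / (real d - 1))" for k
      unfolding C(4) limit_moment_def arg b_def ..
  qed (use C in auto)
qed

end
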